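(* Let $G$ be a Lie group of dimension $\geq 5$. Suppose $G$ admits a left invariant contact structure. Then there is no flat left invariant Riemannian metric on $G$.
   Context: A left invariant contact structure on a Lie group $G$ of dimension $2n+1$ is given by a left invariant 1-form $\eta^+$ with $(d\eta^+)^n\wedge\eta^+\neq0$ pointwise. A Riemannian metric is flat if its sectional curvature vanishes identically. The metric is not assumed to be related to the contact structure. *)

theory Defs
  imports
    "HOL-Analysis.Analysis"
    "HOL-Combinatorics.Permutations"
    "HOL-Algebra.Group"
begin

section \<open>Smooth functions between Euclidean spaces\<close>

text \<open>On an open set of a Euclidean space this is the usual notion of class \<open>C\<^sup>k\<close>: all iterated
  directional derivatives of order at most \<open>k\<close> exist and are continuous.\<close>

primrec Ck_on :: "nat \<Rightarrow> 'e::euclidean_space set \<Rightarrow> ('e \<Rightarrow> 'f::real_normed_vector) \<Rightarrow> bool" where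
  "Ck_on 0 S f \<longleftrightarrow> continuous_on S f"
| "Ck_on (Suc k) S f \<longleftrightarrow>
     (\<forall>x\<in>S. f differentiable (at x)) \<and> (\<forall>v. Ck_on k S (\<lambda>x. frechet_derivative f (at x) v))"

definition smooth_on :: "'e::euclidean_space set \<Rightarrow> ('e \<Rightarrow> 'f::real_normed_vector) \<Rightarrow> bool" where
  "smooth_on S f \<longleftrightarrow> open S \<and> (\<forall>k. Ck_on k S f)"


section \<open>Smooth manifolds and smooth maps\<close>

text \<open>A chart is a pair of a domain and a coordinate map. The dimension of the manifold is the
  dimension of the model space \<open>'e\<close>.\<close>

type_synonym ('a, 'e) chart = "'a set \<times> ('a \<Rightarrow> 'e)"

definition chart_image :: "('a, 'e::euclidean_space) chart \<Rightarrow> 'e set" where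
  "chart_image c = snd c ` fst c"

definition is_chart :: "'a topology \<Rightarrow> ('a, 'e::euclidean_space) chart \<Rightarrow> bool" where
  "is_chart T c \<longleftrightarrow> openin T (fst c) \<and> open (chart_image c) \<and>
     homeomorphic_map (subtopology T (fst c)) (top_of_set (chart_image c)) (snd c)"

text \<open>The expression \<open>\<psi> \<circ> f \<circ> \<phi>\<^sup>-\<^sup>1\<close> of \<open>f\<close> in the charts \<open>c = (U, \<phi>)\<close> and \<open>d = (V, \<psi>)\<close>, and its
  domain \<open>\<phi>(U \<inter> f\<^sup>-\<^sup>1(V))\<close>.\<close>

definition coord_rep ::
    "('a, 'e::euclidean_space) chart \<Rightarrow> ('b, 'f::euclidean_space) chart \<Rightarrow> ('a \<Rightarrow> 'b) \<Rightarrow> 'e \<Rightarrow> 'f" where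
  "coord_rep c d f = snd d \<circ> f \<circ> inv_into (fst c) (snd c)"

definition coord_dom ::
    "('a, 'e::euclidean_space) chart \<Rightarrow> ('b, 'f::euclidean_space) chart \<Rightarrow> ('a \<Rightarrow> 'b) \<Rightarrow> 'e set" where
  "coord_dom c d f = snd c ` (fst c \<inter> f -` fst d)"

locale smooth_manifold =
  fixes T :: "'a topology" and A :: "('a, 'e::euclidean_space) chart set"
  assumes Hausdorff: "Hausdorff_space T"
    and second_countable: "second_countable T"
    and charts: "c \<in> A \<Longrightarrow> is_chart T c"
    and charts_cover: "(\<Union>c\<in>A. fst c) = topspace T"
    and charts_compatible:
      "c \<in> A \<Longrightarrow> d \<in> A \<Longrightarrow> smooth_on (coord_dom c d id) (coord_rep c d id)"

definition smooth_map ::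
    "'a topology \<Rightarrow> ('a, 'e::euclidean_space) chart set \<Rightarrow>
     'b topology \<Rightarrow> ('b, 'f::euclidean_space) chart set \<Rightarrow> ('a \<Rightarrow> 'b) \<Rightarrow> bool" where
  "smooth_map T A T' B f \<longleftrightarrow> continuous_map T T' f \<and>
     (\<forall>c\<in>A. \<forall>d\<in>B. smooth_on (coord_dom c d f) (coord_rep c d f))"

definition prod_atlas ::
    "('a, 'e::euclidean_space) chart set \<Rightarrow> ('b, 'f::euclidean_space) chart set \<Rightarrow>
     ('a \<times> 'b, 'e \<times> 'f) chart set" where
  "prod_atlas A B = {(fst c \<times> fst d, map_prod (snd c) (snd d)) | c d. c \<in> A \<and> d \<in> B}"


section \<open>Lie groups\<close>

locale lie_group = group G + smooth_manifold T A
  for G :: "('a, 'b) monoid_scheme" (structure)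
    and T :: "'a topology" and A :: "('a, 'e::euclidean_space) chart set" +
  assumes topspace_carrier: "topspace T = carrier G"
    and smooth_mult: "smooth_map (prod_topology T T) (prod_atlas A A) T A (\<lambda>(x, y). x \<otimes> y)"
    and smooth_inv: "smooth_map T A T A (\<lambda>x. inv x)"


section \<open>Differential 1-forms and Riemannian metrics\<close>

text \<open>A tensor field is given by its coordinate expressions: \<open>\<eta> c x v\<close> is the value, on the tangent
  vector with components \<open>v\<close> in the chart \<open>c\<close>, of the form \<open>\<eta>\<close> at the point with coordinates \<open>x\<close>
  in \<open>c\<close>. The expressions in different charts are related by pulling back along the transition
  map. Values for \<open>c\<close> outside the atlas or \<open>x\<close> outside the image of \<open>c\<close> are irrelevant.\<close>

type_synonym ('a, 'e) one_form = "('a, 'e) chart \<Rightarrow> 'e \<Rightarrow> 'e \<Rightarrow> real"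
type_synonym ('a, 'e) two_tensor = "('a, 'e) chart \<Rightarrow> 'e \<Rightarrow> 'e \<Rightarrow> 'e \<Rightarrow> real"

text \<open>\<open>f\<^sup>*\<eta> = \<eta>\<close>, respectively \<open>f\<^sup>*g = g\<close>, expressed in charts. For \<open>f = id\<close> these are the
  transformation rules under a change of charts.\<close>

definition pullback_invariant1 ::
    "('a, 'e::euclidean_space) chart set \<Rightarrow> ('a \<Rightarrow> 'a) \<Rightarrow> ('a, 'e) one_form \<Rightarrow> bool" where
  "pullback_invariant1 A f \<eta> \<longleftrightarrow>
     (\<forall>c\<in>A. \<forall>d\<in>A. \<forall>x\<in>coord_dom c d f. \<forall>v.
        \<eta> d (coord_rep c d f x) (frechet_derivative (coord_rep c d f) (at x) v) = \<eta> c x v)"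

definition pullback_invariant2 ::
    "('a, 'e::euclidean_space) chart set \<Rightarrow> ('a \<Rightarrow> 'a) \<Rightarrow> ('a, 'e) two_tensor \<Rightarrow> bool" where
  "pullback_invariant2 A f g \<longleftrightarrow>
     (\<forall>c\<in>A. \<forall>d\<in>A. \<forall>x\<in>coord_dom c d f. \<forall>v w.
        g d (coord_rep c d f x) (frechet_derivative (coord_rep c d f) (at x) v)
          (frechet_derivative (coord_rep c d f) (at x) w) = g c x v w)"

definition smooth_one_form ::
    "('a, 'e::euclidean_space) chart set \<Rightarrow> ('a, 'e) one_form \<Rightarrow> bool" where
  "smooth_one_form A \<eta> \<longleftrightarrow>
     (\<forall>c\<in>A. \<forall>x\<in>chart_image c. linear (\<eta> c x)) \<and>
     (\<forall>c\<in>A. \<forall>v. smooth_on (chart_image c) (\<lambda>x. \<eta> c x v)) \<and>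
     pullback_invariant1 A id \<eta>"

definition riemannian_metric ::
    "('a, 'e::euclidean_space) chart set \<Rightarrow> ('a, 'e) two_tensor \<Rightarrow> bool" where
  "riemannian_metric A g \<longleftrightarrow>
     (\<forall>c\<in>A. \<forall>x\<in>chart_image c. bilinear (g c x) \<and>
        (\<forall>v w. g c x v w = g c x w v) \<and> (\<forall>v. v \<noteq> 0 \<longrightarrow> g c x v v > 0)) \<and>
     (\<forall>c\<in>A. \<forall>v w. smooth_on (chart_image c) (\<lambda>x. g c x v w)) \<and>
     pullback_invariant2 A id g"

definition left_invariant1 ::
    "('a, 'b) monoid_scheme \<Rightarrow> ('a, 'e::euclidean_space) chart set \<Rightarrow> ('a, 'e) one_form \<Rightarrow> bool" where
  "left_invariant1 G A \<eta> \<longleftrightarrow> (\<forall>a\<in>carrier G. pullback_invariant1 A (\<lambda>x. a \<otimes>\<^bsub>G\<^esub> x) \<eta>)"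

definition left_invariant2 ::
    "('a, 'b) monoid_scheme \<Rightarrow> ('a, 'e::euclidean_space) chart set \<Rightarrow> ('a, 'e) two_tensor \<Rightarrow> bool" where
  "left_invariant2 G A g \<longleftrightarrow> (\<forall>a\<in>carrier G. pullback_invariant2 A (\<lambda>x. a \<otimes>\<^bsub>G\<^esub> x) g)"


section \<open>Contact forms\<close>

text \<open>A \<open>k\<close>-linear form is a function of a sequence of vectors that depends on the entries with
  index \<open>< k\<close> only.\<close>

definition wedge ::
    "nat \<Rightarrow> nat \<Rightarrow> ((nat \<Rightarrow> 'e) \<Rightarrow> real) \<Rightarrow> ((nat \<Rightarrow> 'e) \<Rightarrow> real) \<Rightarrow> (nat \<Rightarrow> 'e) \<Rightarrow> real" where
  "wedge k l \<alpha> \<beta> v =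
     (\<Sum>\<sigma> | \<sigma> permutes {..<k + l}.
        of_int (sign \<sigma>) * \<alpha> (\<lambda>i. v (\<sigma> i)) * \<beta> (\<lambda>i. v (\<sigma> (k + i)))) / (fact k * fact l)"

text \<open>The \<open>n\<close>-th exterior power of a 2-form.\<close>

primrec wedge_power2 :: "nat \<Rightarrow> ((nat \<Rightarrow> 'e) \<Rightarrow> real) \<Rightarrow> (nat \<Rightarrow> 'e) \<Rightarrow> real" where
  "wedge_power2 0 \<omega> = (\<lambda>v. 1)"
| "wedge_power2 (Suc n) \<omega> = wedge 2 (2 * n) \<omega> (wedge_power2 n \<omega>)"

text \<open>\<open>d\<eta>(X, Y) = X(\<eta>(Y)) - Y(\<eta>(X))\<close> for vector fields \<open>X\<close>, \<open>Y\<close> with constant components in the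
  chart.\<close>

definition ext_deriv ::
    "('e::euclidean_space \<Rightarrow> 'e \<Rightarrow> real) \<Rightarrow> 'e \<Rightarrow> (nat \<Rightarrow> 'e) \<Rightarrow> real" where
  "ext_deriv \<eta> x v =
     frechet_derivative (\<lambda>y. \<eta> y (v 1)) (at x) (v 0) -
     frechet_derivative (\<lambda>y. \<eta> y (v 0)) (at x) (v 1)"

definition contact_form ::
    "('a, 'e::euclidean_space) chart set \<Rightarrow> ('a, 'e) one_form \<Rightarrow> bool" where
  "contact_form A \<eta> \<longleftrightarrow> smooth_one_form A \<eta> \<and>
     (\<exists>n. DIM('e) = 2 * n + 1 \<and>
       (\<forall>c\<in>A. \<forall>x\<in>chart_image c. \<exists>v.
          wedge (2 * n) 1 (wedge_power2 n (ext_deriv (\<eta> c) x)) (\<lambda>u. \<eta> c x (u 0)) v \<noteq> 0))"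


section \<open>Sectional curvature\<close>

text \<open>In the following, \<open>g\<close> is the expression of a metric in one chart. \<open>christoffel g x u v\<close> is the
  covariant derivative at \<open>x\<close>, in the direction \<open>u\<close>, of the vector field with constant components
  \<open>v\<close>, as given by Koszul's formula. In components it is the vector with entries
  \<open>\<Gamma>\<^sup>k\<^sub>i\<^sub>j u\<^sup>i v\<^sup>j\<close>.\<close>

definition christoffel ::
    "('e::euclidean_space \<Rightarrow> 'e \<Rightarrow> 'e \<Rightarrow> real) \<Rightarrow> 'e \<Rightarrow> 'e \<Rightarrow> 'e \<Rightarrow> 'e" where
  "christoffel g x u v =
     (THE z. \<forall>w. g x z w =
        (frechet_derivative (\<lambda>y. g y v w) (at x) u +
         frechet_derivative (\<lambda>y. g y u w) (at x) v -
         frechet_derivative (\<lambda>y. g y u v) (at x) w) / 2)"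

text \<open>\<open>R(u, v)w = \<nabla>\<^sub>u\<nabla>\<^sub>v w - \<nabla>\<^sub>v\<nabla>\<^sub>u w\<close> for vector fields with constant components \<open>u\<close>, \<open>v\<close>, \<open>w\<close>.\<close>

definition riemann_curvature ::
    "('e::euclidean_space \<Rightarrow> 'e \<Rightarrow> 'e \<Rightarrow> real) \<Rightarrow> 'e \<Rightarrow> 'e \<Rightarrow> 'e \<Rightarrow> 'e \<Rightarrow> 'e" where
  "riemann_curvature g x u v w =
     frechet_derivative (\<lambda>y. christoffel g y v w) (at x) u -
     frechet_derivative (\<lambda>y. christoffel g y u w) (at x) v +
     christoffel g x u (christoffel g x v w) - christoffel g x v (christoffel g x u w)"

definition sectional_curvature ::
    "('e::euclidean_space \<Rightarrow> 'e \<Rightarrow> 'e \<Rightarrow> real) \<Rightarrow> 'e \<Rightarrow> 'e \<Rightarrow> 'e \<Rightarrow> real" where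
  "sectional_curvature g x u v =
     g x (riemann_curvature g x u v v) u / (g x u u * g x v v - (g x u v)\<^sup>2)"

definition flat_metric ::
    "('a, 'e::euclidean_space) chart set \<Rightarrow> ('a, 'e) two_tensor \<Rightarrow> bool" where
  "flat_metric A g \<longleftrightarrow>
     (\<forall>c\<in>A. \<forall>x\<in>chart_image c. \<forall>u v. u \<noteq> v \<and> independent {u, v} \<longrightarrow>
        sectional_curvature (g c) x u v = 0)"

end

theory Submission
  imports Defs
begin

text \<open>Left translations identify the tangent spaces of \<open>G\<close> with its Lie algebra, so a left invariant
metric becomes an inner product, its Levi-Civita connection a product \<open>N a b\<close> ("the covariant
derivative of \<open>b\<close> along \<open>a\<close>") with every \<open>N a\<close> skew and \<open>N a b - N b a = [a, b]\<close>, and flatness says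
that \<open>a \<mapsto> N a\<close> is a representation of the Lie algebra. A left invariant 1-form is a vector \<open>\<xi>\<close>,
with \<open>d\<xi>(a, b) = -\<xi> \<bullet> [a, b]\<close>. If it is a contact form, no nonzero vector is orthogonal to \<open>\<xi>\<close> and
in the kernel of \<open>d\<xi>\<close> (\<open>wedge_top_degree_annihilated\<close>).

The structure of flat metric Lie algebras is due to Milnor: the kernel \<open>\<uu>\<close> of the representation is
an abelian ideal, and its orthogonal complement \<open>\<bb>\<close> is an abelian subalgebra. For the second part
let \<open>C\<close> be the Casimir operator of \<open>\<bb>\<close> for the trace form of \<open>N\<close>, and let
\<open>v = \<Sum> N e\<^sub>i e\<^sub>i\<close> over an orthonormal basis of that form. Invariance of the trace form
and vanishing torsion give \<open>N z v = C z\<close> for \<open>z\<close> in \<open>\<bb>\<close>; as \<open>N z\<close> is skew, \<open>C v \<bullet> v = 0\<close>. But \<open>C\<close> is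
negative semidefinite, and its kernel consists of the vectors killed by all \<open>N e\<^sub>i\<close>. So \<open>v\<close> is
killed, hence \<open>C = 0\<close> on \<open>\<bb>\<close>, hence \<open>N = 0\<close> on \<open>\<bb> \<times> \<bb>\<close> (\<open>N_on_rotation_part\<close>). In particular all operators
\<open>N a\<close> commute.

Now put \<open>L a = N a \<xi>\<close>, so that \<open>d\<xi>(a, b) = L a \<bullet> b - L b \<bullet> a\<close>. The form \<open>N a (L b) \<bullet> L c\<close> is symmetric
in \<open>a, b\<close> and skew in \<open>b, c\<close>, so it is zero; with the contact condition on \<open>\<uu>\<close> this forces
\<open>N a (L b)\<close> to be a multiple of the \<open>\<uu>\<close>-component of \<open>\<xi>\<close>, and commutativity then shows that \<open>L\<close> has
rank at most one, \<open>L a = (r \<bullet> a) q\<close>. A vector orthogonal to \<open>\<xi>\<close>, \<open>q\<close> and \<open>r\<close> violates the contact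
condition, so the dimension is at most 3 (\<open>contact_dim_bound\<close>).

The rest relates this algebra to charts. In a chart at the identity the derivative of the
multiplication in its second argument is a frame of left invariant fields. Associativity and
symmetry of second derivatives make its brackets constant (\<open>left_field_bracket\<close>); the gauge
transformation from coordinates to the frame turns Christoffel symbols into \<open>N\<close>
(\<open>christoffel_eq\<close>) and the curvature into the curvature of \<open>N\<close> (\<open>riemann_curvature_frame\<close>).\<close>

section \<open>Orthonormal bases for a bilinear form\<close>

text \<open>A family of maximal cardinality among the orthonormal ones spans: otherwise the component of some
vector orthogonal to it could be normalised and added.\<close>

lemma orthonormal_family_of_form:
  fixes Q :: "'e::euclidean_space \<Rightarrow> 'e \<Rightarrow> real"
  assumes Q: "bilinear Q" "\<And>x y. Q x y = Q y x"
    and S: "subspace S" and pos: "\<And>x. x \<in> S \<Longrightarrow> x \<noteq> 0 \<Longrightarrow> Q x x > 0"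
  obtains B where "finite B" "B \<subseteq> S" "independent B"
    "\<And>x y. x \<in> B \<Longrightarrow> y \<in> B \<Longrightarrow> Q x y = (if x = y then 1 else 0)"
    "\<And>x. x \<in> S \<Longrightarrow> x = (\<Sum>e\<in>B. Q x e *\<^sub>R e)"
proof -
  define ON where "ON B \<longleftrightarrow> finite B \<and> B \<subseteq> S \<and>
    (\<forall>x\<in>B. \<forall>y\<in>B. Q x y = (if x = y then 1 else 0))" for B
  have lin: "linear (\<lambda>x. Q x y)" for y
    using Q(1) by (simp add: bilinear_def)
  have coeff: "Q (\<Sum>e\<in>B. c e *\<^sub>R e) f = c f" if "ON B" "f \<in> B" for B c f
  proof -
    have "Q (\<Sum>e\<in>B. c e *\<^sub>R e) f = (\<Sum>e\<in>B. c e * Q e f)"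
      by (simp add: linear_sum[OF lin] linear_scale[OF lin])
    also have "\<dots> = (\<Sum>e\<in>B. if e = f then c e else 0)"
      using that by (intro sum.cong) (auto simp: ON_def)
    finally show ?thesis
      using that by (simp add: ON_def)
  qed
  have indep: "independent B" if "ON B" for B
  proof -
    have "finite B" using that by (simp add: ON_def)
    moreover have "c f = 0" if "(\<Sum>e\<in>B. c e *\<^sub>R e) = 0" "f \<in> B" for c f
      using coeff[OF \<open>ON B\<close> \<open>f \<in> B\<close>, of c] that linear_0[OF lin] by simp
    ultimately show ?thesis
      by (auto simp: dependent_finite)
  qed
  have "ON {}" by (simp add: ON_def)
  moreover have "card B \<le> DIM('e)" if "ON B" for B
    using independent_bound[OF indep[OF that]] by simp
  ultimately obtain B where B: "ON B" and max: "\<And>C. ON C \<Longrightarrow> card C \<le> card B"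
    using ex_has_greatest_nat[of ON "{}" card "Suc DIM('e)"] by (metis le_imp_less_Suc)
  have "x = (\<Sum>e\<in>B. Q x e *\<^sub>R e)" if "x \<in> S" for x
  proof (rule ccontr)
    define r where "r = x - (\<Sum>e\<in>B. Q x e *\<^sub>R e)"
    assume "x \<noteq> (\<Sum>e\<in>B. Q x e *\<^sub>R e)"
    then have "r \<noteq> 0" by (simp add: r_def)
    have "r \<in> S"
      unfolding r_def using B that
      by (intro subspace_diff subspace_sum subspace_scale S) (auto simp: ON_def)
    then have rr: "Q r r > 0" using pos \<open>r \<noteq> 0\<close> by simp
    have re: "Q r e = 0" if "e \<in> B" for e
      unfolding r_def using coeff[OF B that] by (simp add: linear_diff[OF lin])
    define n where "n = (1 / sqrt (Q r r)) *\<^sub>R r"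
    have "Q n n = 1"
      using rr by (simp add: n_def bilinear_lmul[OF Q(1)] bilinear_rmul[OF Q(1)] field_simps)
    moreover have "Q n e = 0" if "e \<in> B" for e
      using re[OF that] by (simp add: n_def bilinear_lmul[OF Q(1)])
    moreover from this have "Q e n = 0" if "e \<in> B" for e
      using that Q(2) by metis
    moreover have "n \<in> S" using \<open>r \<in> S\<close> S by (simp add: n_def subspace_scale)
    moreover have "n \<notin> B"
      using calculation(1,2) by fastforce
    ultimately have "ON (insert n B)"
      using B by (auto simp: ON_def)
    from max[OF this] show False
      using \<open>n \<notin> B\<close> B by (simp add: ON_def)
  qed
  with B indep[OF B] show thesis
    by (intro that) (auto simp: ON_def)
qed

text \<open>This changes coordinates so that an arbitrary inner product becomes the standard one.\<close>

lemma orthonormal_frame_of_form: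
  fixes Q :: "'e::euclidean_space \<Rightarrow> 'e \<Rightarrow> real"
  assumes Q: "bilinear Q" "\<And>x y. Q x y = Q y x" "\<And>x. x \<noteq> 0 \<Longrightarrow> Q x x > 0"
  obtains P :: "'e \<Rightarrow> 'e" where "linear P" "bij P" "\<And>a b. Q (P a) (P b) = a \<bullet> b"
proof -
  obtain B where B: "finite B" "B \<subseteq> UNIV" "independent B"
    "\<And>x y. x \<in> B \<Longrightarrow> y \<in> B \<Longrightarrow> Q x y = (if x = y then 1 else 0)"
    "\<And>x. x \<in> UNIV \<Longrightarrow> x = (\<Sum>e\<in>B. Q x e *\<^sub>R e)"
    by (rule orthonormal_family_of_form[OF Q(1,2) subspace_UNIV Q(3)]) (assumption | rule that)+
  have "x \<in> span B" for x
    by (subst B(5)[OF UNIV_I]) (intro span_sum span_scale span_base)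
  then have "card B = DIM('e)"
    using basis_card_eq_dim[of B UNIV] B(3) by auto
  then obtain f where f: "bij_betw f (Basis :: 'e set) B"
    using B(1) finite_same_card_bij[of "Basis :: 'e set" B] by auto
  define P where "P a = (\<Sum>b\<in>Basis. (a \<bullet> b) *\<^sub>R f b)" for a
  have linP: "linear P"
    by (auto intro!: linearI simp: P_def inner_add_left scaleR_add_left sum.distrib scaleR_sum_right)
  have QP: "Q (P a) (P b) = a \<bullet> b" for a b
  proof -
    have lin: "linear (Q x)" "linear (\<lambda>x. Q x y)" for x y
      using Q(1) by (auto simp: bilinear_def)
    have "Q (P a) (P b) = (\<Sum>j\<in>Basis. \<Sum>i\<in>Basis. (b \<bullet> j) * ((a \<bullet> i) * Q (f i) (f j)))"
      unfolding P_def by (simp add: linear_sum[OF lin(1)] linear_sum[OF lin(2)]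
          linear_scale[OF lin(1)] linear_scale[OF lin(2)] sum_distrib_left)
    also have "\<dots> = (\<Sum>j\<in>Basis. \<Sum>i\<in>Basis. if i = j then (a \<bullet> i) * (b \<bullet> i) else 0)"
    proof (intro sum.cong refl)
      fix i j :: 'e assume ij: "i \<in> Basis" "j \<in> Basis"
      then have "f i \<in> B" "f j \<in> B" "f i = f j \<longleftrightarrow> i = j"
        using f by (auto simp: bij_betw_def inj_on_def)
      then show "(b \<bullet> j) * ((a \<bullet> i) * Q (f i) (f j)) = (if i = j then (a \<bullet> i) * (b \<bullet> i) else 0)"
        using B(4) by simp
    qed
    also have "\<dots> = a \<bullet> b"
      by (simp add: euclidean_inner[of a b])
    finally show ?thesis .
  qed
  have "inj P"
  proof (rule linear_injective_0[OF linP, THEN iffD2], intro allI impI)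
    fix a assume "P a = 0"
    then show "a = 0" using QP[of a a] bilinear_lzero[OF Q(1)] by simp
  qed
  then have "bij P"
    using linear_injective_imp_surjective[OF linP] by (simp add: bij_def)
  with linP show thesis
    by (rule that) (rule QP)
qed

text \<open>The tensor \<open>\<Sum> e \<otimes> e\<close> is invariant under every operator \<open>T\<close> whose matrix is skew. It is used for the
standard basis and for a basis that is orthonormal for a trace form.\<close>

lemma sum_skew_coefficients:
  fixes h :: "'v::real_vector \<Rightarrow> 'v \<Rightarrow> 'w::real_vector"
  assumes h: "\<And>y. linear (h y)" "\<And>y. linear (\<lambda>x. h x y)"
    and T: "\<And>e. e \<in> B \<Longrightarrow> T e = (\<Sum>j\<in>B. a e j *\<^sub>R j)"
    and a: "\<And>e j. e \<in> B \<Longrightarrow> j \<in> B \<Longrightarrow> a e j = - a j e"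
  shows "(\<Sum>e\<in>B. h (T e) e + h e (T e)) = 0"
proof -
  have "(\<Sum>e\<in>B. h (T e) e) = (\<Sum>e\<in>B. \<Sum>j\<in>B. a e j *\<^sub>R h j e)"
    by (simp add: T linear_sum[OF h(2)] linear_scale[OF h(2)])
  also have "\<dots> = (\<Sum>j\<in>B. \<Sum>e\<in>B. a e j *\<^sub>R h j e)"
    by (rule sum.swap)
  also have "\<dots> = (\<Sum>j\<in>B. \<Sum>e\<in>B. - (a j e *\<^sub>R h j e))"
  proof (intro sum.cong refl)
    fix j e assume "j \<in> B" "e \<in> B"
    then show "a e j *\<^sub>R h j e = - (a j e *\<^sub>R h j e)"
      using a[of e j] by simp
  qed
  also have "\<dots> = - (\<Sum>e\<in>B. h e (T e))"
    by (simp add: T linear_sum[OF h(1)] linear_scale[OF h(1)] sum_negf)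
  finally show ?thesis
    by (simp add: sum.distrib)
qed

section \<open>Flat metric Lie algebras\<close>

text \<open>The Lie algebra of a Lie group with a flat left invariant metric: \<open>N\<close> is the Levi-Civita
connection on left invariant fields and \<open>N a b - N b a\<close> is the Lie bracket, as the torsion vanishes.
The law \<open>rep\<close> is flatness.\<close>

locale flat_lie_product =
  fixes N :: "'e::euclidean_space \<Rightarrow> 'e \<Rightarrow> 'e"
  assumes bil: "bilinear N"
    and skew: "N a b \<bullet> c = - (b \<bullet> N a c)"
    and rep: "N (N a b - N b a) c = N a (N b c) - N b (N a c)"
begin

lemmas N_simps = bilinear_ladd[OF bil] bilinear_radd[OF bil] bilinear_lsub[OF bil]
  bilinear_rsub[OF bil] bilinear_lmul[OF bil] bilinear_rmul[OF bil] bilinear_lneg[OF bil]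
  bilinear_rneg[OF bil] bilinear_lzero[OF bil] bilinear_rzero[OF bil]

lemma linear_N: "linear (N a)" "linear (\<lambda>a. N a b)"
  using bil by (auto simp: bilinear_def)

text \<open>The names refer to the action of the group by affine isometries of Euclidean space, whose linear
part is \<open>N\<close>.\<close>

definition translation_part :: "'e set" where
  "translation_part = {x. \<forall>y. N x y = 0}"

definition rotation_part :: "'e set" where
  "rotation_part = orthogonal_comp translation_part"

lemma subspace_translation_part: "subspace translation_part"
  by (auto simp: subspace_def translation_part_def N_simps)

lemma subspace_rotation_part: "subspace rotation_part"
  unfolding rotation_part_def by (rule subspace_orthogonal_comp)

lemma rotation_partI: "(\<And>y. y \<in> translation_part \<Longrightarrow> x \<bullet> y = 0) \<Longrightarrow> x \<in> rotation_part"
  by (auto simp: rotation_part_def orthogonal_comp_def orthogonal_def inner_commute)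

lemma rotation_partD: "x \<in> rotation_part \<Longrightarrow> y \<in> translation_part \<Longrightarrow> x \<bullet> y = 0"
  by (auto simp: rotation_part_def orthogonal_comp_def orthogonal_def inner_commute)

lemma translation_rotation_decomposition:
  obtains y z where "y \<in> translation_part" "z \<in> rotation_part" "x = y + z"
proof -
  obtain y z where yz: "y \<in> span translation_part" "\<And>w. w \<in> span translation_part \<Longrightarrow> orthogonal z w" "x = y + z"
    using orthogonal_subspace_decomp_exists[of translation_part x] by metis
  have "span translation_part = translation_part"
    using subspace_translation_part by simp
  with yz have "y \<in> translation_part" "z \<in> rotation_part"
    by (auto intro: rotation_partI simp: orthogonal_def)
  with that yz(3) show thesis by blast
qed

text \<open>As the kernel of a representation, the translations form an ideal, and \<open>N x y = [x, y]\<close> if \<open>y\<close> is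
a translation.\<close>

lemma N_translation_part: "y \<in> translation_part \<Longrightarrow> N x y \<in> translation_part"
  using rep[of x y] by (auto simp: translation_part_def N_simps)

lemma N_rotation_part: "y \<in> rotation_part \<Longrightarrow> N x y \<in> rotation_part"
  by (rule rotation_partI) (simp add: skew rotation_partD N_translation_part)

text \<open>Since \<open>N y\<close> is skew, this is \<open>- tr (N x \<circ> N y)\<close>.\<close>

definition trace_form :: "'e \<Rightarrow> 'e \<Rightarrow> real" where
  "trace_form x y = (\<Sum>k\<in>Basis. N x k \<bullet> N y k)"

lemma bilinear_trace_form: "bilinear trace_form"
  unfolding bilinear_def trace_form_def
  by (auto intro!: linearI simp: N_simps inner_left_distrib inner_right_distrib
      sum.distrib sum_distrib_left)

lemma trace_form_commute: "trace_form x y = trace_form y x"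
  by (simp add: trace_form_def inner_commute)

lemma trace_form_pos:
  assumes "x \<in> rotation_part" "x \<noteq> 0"
  shows "trace_form x x > 0"
proof -
  have nonneg: "trace_form x x \<ge> 0"
    by (auto simp: trace_form_def intro: sum_nonneg)
  have "trace_form x x \<noteq> 0"
  proof
    assume "trace_form x x = 0"
    then have zero: "\<forall>k\<in>Basis. N x k = 0"
      by (auto simp: trace_form_def sum_nonneg_eq_0_iff)
    have "N x y = 0" for y
      using linear_eq_0_on_span[OF linear_N(1)[of x], of Basis y] zero by auto
    then have "x \<in> translation_part" by (simp add: translation_part_def)
    with assms show False using rotation_partD[of x x] by simp
  qed
  with nonneg show ?thesis by simp
qed

text \<open>Expanding the brackets with \<open>rep\<close>, the terms with \<open>N z\<close> outermost cancel because \<open>N z\<close> is skew, and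
the others are the derivative of a trace under \<open>N z\<close>.\<close>

lemma trace_form_invariant:
  "trace_form (N z x - N x z) y + trace_form x (N z y - N y z) = 0"
proof -
  define h where "h a b = N x a \<bullet> N y b" for a b
  have "(\<Sum>k\<in>Basis. h (N z k) k + h k (N z k)) = 0"
  proof (rule sum_skew_coefficients[where a = "\<lambda>e j. N z e \<bullet> j"])
    show "linear (h a)" "linear (\<lambda>a. h a b)" for a b
      by (auto intro!: linearI simp: h_def N_simps inner_left_distrib inner_right_distrib)
    show "N z e = (\<Sum>j\<in>Basis. (N z e \<bullet> j) *\<^sub>R j)" for e
      by (simp add: euclidean_representation)
    show "N z e \<bullet> j = - (N z j \<bullet> e)" for e j
      using skew[of z e j] by (simp add: inner_commute)
  qed
  moreover have "trace_form (N z x - N x z) y + trace_form x (N z y - N y z)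
      = - (\<Sum>k\<in>Basis. h (N z k) k + h k (N z k))"
    by (simp add: trace_form_def rep h_def inner_diff_left inner_diff_right skew[of z]
        sum_subtractf sum.distrib sum_negf)
  ultimately show ?thesis by simp
qed

text \<open>This is the step in Milnor's theorem that excludes semisimple rotation algebras. It replaces
Whitehead's lemma on first cohomology: the identity is a cocycle with values in \<open>N\<close>, and the
Casimir operator \<open>C\<close> would make it a coboundary, which skewness of \<open>N\<close> forbids.\<close>

lemma N_on_rotation_part:
  assumes x: "x \<in> rotation_part" and y: "y \<in> rotation_part"
  shows "N x y = 0"
proof -
  obtain B where B: "finite B" "B \<subseteq> rotation_part" and "independent B"
    and "\<And>x y. x \<in> B \<Longrightarrow> y \<in> B \<Longrightarrow> trace_form x y = (if x = y then 1 else 0)"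
    and expand: "\<And>x. x \<in> rotation_part \<Longrightarrow> x = (\<Sum>e\<in>B. trace_form x e *\<^sub>R e)"
    by (rule orthonormal_family_of_form[OF bilinear_trace_form trace_form_commute
        subspace_rotation_part trace_form_pos]) (assumption | rule that)+
  define v where "v = (\<Sum>e\<in>B. N e e)"
  define C where "C w = (\<Sum>e\<in>B. N e (N e w))" for w
  \<comment> \<open>Commuting \<open>N z\<close> past \<open>N e\<close> costs brackets \<open>[z, e]\<close>, whose total contribution vanishes by invariance.\<close>
  have cocycle: "N z v = C z" if z: "z \<in> rotation_part" for z
  proof -
    have "(\<Sum>e\<in>B. N (N z e - N e z) e + N e (N z e - N e z)) = 0"
    proof (rule sum_skew_coefficients[where a = "\<lambda>e j. trace_form (N z e - N e z) j"])
      show "N z e - N e z = (\<Sum>j\<in>B. trace_form (N z e - N e z) j *\<^sub>R j)" if "e \<in> B" for e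
        using that B z
        by (intro expand subspace_diff[OF subspace_rotation_part] N_rotation_part) auto
      show "trace_form (N z e - N e z) j = - trace_form (N z j - N j z) e" for e j
        using trace_form_invariant[of z e j] trace_form_commute[of e] by simp
    qed (rule linear_N)+
    moreover have "N (N z e - N e z) e + N e (N z e - N e z) = N z (N e e) - N e (N e z)" for e
      using rep[of z e e] by (simp add: N_simps)
    ultimately show ?thesis
      by (simp add: v_def C_def linear_sum[OF linear_N(1)] sum_subtractf)
  qed
  have vN: "v \<in> rotation_part"
    unfolding v_def using B by (intro subspace_sum[OF subspace_rotation_part] N_rotation_part) auto
  \<comment> \<open>Hence \<open>C\<close> is negative semidefinite, with kernel the common kernel of the \<open>N e\<close>.\<close>
  have C_inner: "C w \<bullet> w = - (\<Sum>e\<in>B. N e w \<bullet> N e w)" for w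
    unfolding C_def inner_sum_left sum_negf[symmetric] by (rule sum.cong[OF refl]) (rule skew)
  have C_zero: "N e w = 0" if "C w \<bullet> w = 0" "e \<in> B" for e w
  proof -
    have "\<forall>e\<in>B. N e w \<bullet> N e w = 0"
      using that(1) B(1) by (subst sum_nonneg_eq_0_iff[symmetric]) (auto simp: C_inner)
    with that(2) show ?thesis by simp
  qed
  have "C v \<bullet> v = 0"
    using cocycle[OF vN] skew[of v v v] by (simp add: inner_commute)
  then have Nv: "N e v = 0" if "e \<in> B" for e
    using C_zero that by blast
  have N_expand: "N z w = (\<Sum>e\<in>B. trace_form z e *\<^sub>R N e w)" if "z \<in> rotation_part" for z w
    by (subst expand[OF that]) (simp add: linear_sum[OF linear_N(2)] N_simps)
  have "C y = 0"
    using cocycle[OF y] N_expand[OF y, of v] Nv by simp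
  then have "N e y = 0" if "e \<in> B" for e
    using C_zero[of y] that by simp
  then show ?thesis
    using N_expand[OF x, of y] by simp
qed

lemma N_rotation_part_right:
  assumes "y \<in> rotation_part"
  shows "N x y = 0"
proof -
  obtain u v where "u \<in> translation_part" "v \<in> rotation_part" "x = u + v"
    using translation_rotation_decomposition .
  then show ?thesis
    using N_on_rotation_part[OF _ assms, of v] by (simp add: N_simps translation_part_def)
qed

text \<open>Brackets of rotations vanish, and translations act by zero.\<close>

lemma N_commute: "N x (N y w) = N y (N x w)"
proof -
  obtain x' x'' where dx: "x' \<in> translation_part" "x'' \<in> rotation_part" "x = x' + x''"
    using translation_rotation_decomposition .
  obtain y' y'' where dy: "y' \<in> translation_part" "y'' \<in> rotation_part" "y = y' + y''"
    using translation_rotation_decomposition .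
  note d = dx dy
  have "N x' w = 0" "N y' w = 0" for w using d by (auto simp: translation_part_def)
  moreover have "N (N x'' y'' - N y'' x'') w = 0"
    using N_on_rotation_part d by (simp add: N_simps)
  ultimately show ?thesis
    using rep[of x'' y'' w] d by (simp add: N_simps)
qed

text \<open>The hypothesis is the contact condition for the 1-form \<open>\<lambda>a. \<xi> \<bullet> a\<close>. It is used twice: on translations,
to compute \<open>N x (L y)\<close>, and at the end on a vector orthogonal to three given ones.\<close>

theorem contact_dim_bound:
  assumes nondeg: "\<And>z. \<xi> \<bullet> z = 0 \<Longrightarrow> (\<And>w. \<xi> \<bullet> (N z w - N w z) = 0) \<Longrightarrow> z = 0"
  shows "DIM('e) \<le> 3"
proof (rule ccontr)
  assume dim: "\<not> DIM('e) \<le> 3"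
  define L where "L x = N x \<xi>" for x
  have L_lin: "linear L" unfolding L_def by (rule linear_N)
  have xi_bracket: "\<xi> \<bullet> (N z w - N w z) = L w \<bullet> z - L z \<bullet> w" for z w
    using skew[of z \<xi> w] skew[of w \<xi> z] by (simp add: L_def inner_diff_right)
  obtain p p' where p: "p \<in> translation_part" "p' \<in> rotation_part" "\<xi> = p + p'"
    using translation_rotation_decomposition .
  have Lp: "L x = N x p" for x
    using p N_rotation_part_right by (simp add: L_def N_simps)
  have L_par: "L x \<in> translation_part" for x
    by (simp add: Lp N_translation_part p)
  have xi_par: "\<xi> \<bullet> z = p \<bullet> z" if "z \<in> translation_part" for z
    using p that rotation_partD[of p' z] by (simp add: inner_add_left)
  \<comment> \<open>For a translation \<open>z\<close> the term \<open>L z\<close> vanishes, so the contact condition says that \<open>p\<close> and the range of \<open>L\<close> span the translations.\<close>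
  have nondeg_par: "z = 0" if "z \<in> translation_part" "p \<bullet> z = 0" "\<And>w. L w \<bullet> z = 0" for z
  proof (rule nondeg)
    show "\<xi> \<bullet> z = 0" using that xi_par by simp
    show "\<xi> \<bullet> (N z w - N w z) = 0" for w
      using that by (simp add: xi_bracket) (simp add: L_def translation_part_def)
  qed
  have pL: "p \<bullet> L x = 0" for x
    using skew[of x p p] by (simp add: Lp inner_commute)
  have comm: "N x (L y) = N y (L x)" for x y
    by (simp add: L_def N_commute)
  have cubic: "N x (L y) \<bullet> L z = 0" for x y z
  proof -
    define c where "c x y z = N x (L y) \<bullet> L z" for x y z
    have sym: "c x y z = c y x z" for x y z by (simp add: c_def comm[of x])
    have anti: "c x y z = - c x z y" for x y z using skew[of x "L y" "L z"] by (simp add: c_def inner_commute)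
    \<comment> \<open>Going around the hexagon of the six permutations of the arguments changes the sign three times.\<close>
    have "c x y z = - c x y z"
      using sym[of x y z] anti[of y x z] sym[of y z x] anti[of z y x] sym[of z x y] anti[of x z y]
      by simp
    then show ?thesis by (simp add: c_def)
  qed
  \<comment> \<open>Both sides are translations with the same inner products with \<open>p\<close> and with the range of \<open>L\<close>.\<close>
  have NL: "(p \<bullet> p) *\<^sub>R N x (L y) = - (L x \<bullet> L y) *\<^sub>R p" for x y
  proof -
    have "(p \<bullet> p) *\<^sub>R N x (L y) + (L x \<bullet> L y) *\<^sub>R p = 0"
    proof (rule nondeg_par)
      show "(p \<bullet> p) *\<^sub>R N x (L y) + (L x \<bullet> L y) *\<^sub>R p \<in> translation_part"
        by (intro subspace_add subspace_scale subspace_translation_part N_translation_part L_par p)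
      have "p \<bullet> N x (L y) = - (L x \<bullet> L y)"
        using skew[of x p "L y"] by (simp add: Lp)
      then show "p \<bullet> ((p \<bullet> p) *\<^sub>R N x (L y) + (L x \<bullet> L y) *\<^sub>R p) = 0"
        by (simp add: inner_add_right)
      show "L w \<bullet> ((p \<bullet> p) *\<^sub>R N x (L y) + (L x \<bullet> L y) *\<^sub>R p) = 0" for w
        using cubic[of x y w] pL[of w] by (simp add: inner_add_right inner_commute)
    qed
    then show ?thesis by (simp add: eq_neg_iff_add_eq_0)
  qed
  \<comment> \<open>Apply \<open>N z\<close> to the previous identity; the left-hand side is then symmetric in \<open>x\<close> and \<open>z\<close>.\<close>
  have rank1: "(L x \<bullet> L y) *\<^sub>R L z = (L z \<bullet> L y) *\<^sub>R L x" for x y z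
  proof -
    have "(p \<bullet> p) *\<^sub>R N z (N x (L y)) = - ((L x \<bullet> L y) *\<^sub>R L z)" for x z
      using arg_cong[OF NL[of x y], of "N z"] by (simp add: N_simps Lp)
    from this[of z x] this[of x z] show ?thesis
      using N_commute[of z x "L y"] by simp
  qed
  obtain q r where qr: "\<And>z. L z = (r \<bullet> z) *\<^sub>R q"
  proof (cases "\<exists>x. L x \<noteq> 0")
    case True
    then obtain x where x: "L x \<noteq> 0" by blast
    \<comment> \<open>Take \<open>q = L x\<close>; then \<open>r\<close> represents the functional \<open>z \<mapsto> (L z \<bullet> L x) / (L x \<bullet> L x)\<close>.\<close>
    define r where "r = (1 / (L x \<bullet> L x)) *\<^sub>R adjoint L (L x)"
    have "L z = (r \<bullet> z) *\<^sub>R L x" for z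
    proof -
      have "r \<bullet> z = (L z \<bullet> L x) / (L x \<bullet> L x)"
        using adjoint_works[OF L_lin, of z "L x"] by (simp add: r_def inner_commute)
      moreover have "L z = ((L z \<bullet> L x) / (L x \<bullet> L x)) *\<^sub>R L x"
        using arg_cong[OF rank1[of x x z], of "\<lambda>v. (1 / (L x \<bullet> L x)) *\<^sub>R v"] x by simp
      ultimately show ?thesis by simp
    qed
    then show ?thesis using that by blast
  next
    case False
    then show ?thesis using that[of 0 0] by simp
  qed
  have "dim {\<xi>, q, r} \<le> card {\<xi>, q, r}"
    by (intro dim_le_card') simp
  also have "\<dots> \<le> 3"
    using card_length[of "[\<xi>, q, r]"] by simp
  finally have "dim {\<xi>, q, r} < DIM('e)"
    using dim by simp
  then obtain z where z: "z \<noteq> 0" "\<And>y. y \<in> span {\<xi>, q, r} \<Longrightarrow> orthogonal z y"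
    by (rule orthogonal_to_subspace_exists) (rule that)
  have "z \<bullet> \<xi> = 0" "z \<bullet> q = 0" "z \<bullet> r = 0"
    using z(2) by (auto simp: orthogonal_def span_base)
  then have "z = 0"
    by (intro nondeg) (auto simp: xi_bracket qr inner_commute)
  with z(1) show False by simp
qed

end

section \<open>Algebraic curvature tensors\<close>

text \<open>The sectional curvature determines the curvature tensor. Polarising in \<open>a\<close>, with pair symmetry, and
then in \<open>b\<close> makes \<open>R\<close> skew in its first three arguments, so the cyclic sum is \<open>3 R\<close>.\<close>

lemma curvature_tensor_vanishes:
  fixes R :: "'v::real_vector \<Rightarrow> 'v \<Rightarrow> 'v \<Rightarrow> 'v \<Rightarrow> real"
  assumes add1: "\<And>a a' b c d. R (a + a') b c d = R a b c d + R a' b c d"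
    and add3: "\<And>a b c c' d. R a b (c + c') d = R a b c d + R a b c' d"
    and skew12: "\<And>a b c d. R a b c d = - R b a c d"
    and skew34: "\<And>a b c d. R a b c d = - R a b d c"
    and bianchi: "\<And>a b c d. R a b c d + R b c a d + R c a b d = 0"
    and sectional: "\<And>a b. R a b b a = 0"
  shows "R a b c d = 0"
proof -
  have add2: "R a (b + b') c d = R a b c d + R a b' c d" for a b b' c d
    using add1[of b b' a c d] skew12[of a _ c d] by simp
  have add4: "R a b c (d + d') = R a b c d + R a b c d'" for a b c d d'
    using add3[of a b d d' c] skew34[of a b c] by simp
  \<comment> \<open>Pair symmetry comes from the octahedron of four Bianchi identities.\<close>
  have pair: "R a b c d = R c d a b" for a b c d
    using bianchi[of a b c d] bianchi[of b c d a] bianchi[of c d a b] bianchi[of d a b c]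
      skew12[of a b c d] skew12[of b c a d] skew12[of c a b d]
      skew12[of b c d a] skew12[of c d b a] skew12[of d b c a]
      skew12[of c d a b] skew12[of d a c b] skew12[of a c d b]
      skew12[of d a b c] skew12[of a b d c] skew12[of b d a c]
      skew34[of a b c d] skew34[of b c a d] skew34[of c a b d]
      skew34[of c d a b] skew34[of a d b c] skew34[of b d a c]
      skew34[of d a b c] skew34[of d b c a] skew34[of a c d b]
    by linarith
  have polarized: "R a b b d = 0" for a b d
  proof -
    have "R a b b a + R d b b a + (R a b b d + R d b b d) = 0"
      using sectional[of "a + d" b] by (simp only: add1 add4)
    moreover have "R d b b a = R a b b d"
      using pair[of a b b d] skew12[of b d a b] skew34[of d b a b] by linarith
    ultimately show ?thesis
      using sectional[of a b] sectional[of d b] by linarith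
  qed
  have skew23: "R a b c d = - R a c b d" for a b c d
  proof -
    have "R a b b d + R a c b d + (R a b c d + R a c c d) = 0"
      using polarized[of a "b + c" d] by (simp only: add2 add3)
    then show ?thesis
      using polarized[of a b d] polarized[of a c d] by linarith
  qed
  show ?thesis
    using bianchi[of a b c d] skew23[of b c a d] skew12[of b a c d] skew12[of c a b d]
      skew23[of a c b d] by linarith
qed

section \<open>Forms of top degree\<close>

definition multilinear_form :: "nat \<Rightarrow> ((nat \<Rightarrow> 'e::real_vector) \<Rightarrow> real) \<Rightarrow> bool" where
  "multilinear_form k \<alpha> \<longleftrightarrow>
     (\<forall>v w. (\<forall>i<k. v i = w i) \<longrightarrow> \<alpha> v = \<alpha> w) \<and> (\<forall>j<k. \<forall>v. linear (\<lambda>x. \<alpha> (v(j := x))))"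

text \<open>The interior product of \<open>\<alpha>\<close> with \<open>z\<close> vanishes in every slot.\<close>

definition annihilates :: "nat \<Rightarrow> 'e \<Rightarrow> ((nat \<Rightarrow> 'e) \<Rightarrow> real) \<Rightarrow> bool" where
  "annihilates k z \<alpha> \<longleftrightarrow> (\<forall>v. (\<exists>i<k. v i = z) \<longrightarrow> \<alpha> v = 0)"

lemma multilinear_wedge:
  assumes \<alpha>: "multilinear_form k \<alpha>" and \<beta>: "multilinear_form l \<beta>"
  shows "multilinear_form (k + l) (wedge k l \<alpha> \<beta>)"
  unfolding multilinear_form_def
proof (intro conjI allI impI)
  fix v w :: "nat \<Rightarrow> 'a" assume vw: "\<forall>i<k + l. v i = w i"
  have "\<alpha> (\<lambda>i. v (\<sigma> i)) = \<alpha> (\<lambda>i. w (\<sigma> i)) \<and> \<beta> (\<lambda>i. v (\<sigma> (k + i))) = \<beta> (\<lambda>i. w (\<sigma> (k + i)))"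
    if "\<sigma> permutes {..<k + l}" for \<sigma>
  proof -
    have "v (\<sigma> i) = w (\<sigma> i)" if "i < k + l" for i
      using vw permutes_in_image[OF \<open>\<sigma> permutes _\<close>, of i] that by simp
    then show ?thesis using \<alpha> \<beta> by (simp add: multilinear_form_def)
  qed
  then show "wedge k l \<alpha> \<beta> v = wedge k l \<alpha> \<beta> w"
    by (simp add: wedge_def)
next
  fix j and v :: "nat \<Rightarrow> 'a" assume j: "j < k + l"
  have "linear (\<lambda>x. of_int (sign \<sigma>) * \<alpha> (\<lambda>i. (v(j := x)) (\<sigma> i)) * \<beta> (\<lambda>i. (v(j := x)) (\<sigma> (k + i))))" if \<sigma>: "\<sigma> permutes {..<k + l}" for \<sigma>
  proof -
    obtain m where m: "m < k + l" "\<sigma> m = j"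
      using j permutes_image[OF \<sigma>] by (metis imageE lessThan_iff)
    have hit: "\<sigma> i = j \<longleftrightarrow> i = m" for i
      using m permutes_inj[OF \<sigma>] by (auto dest: injD)
    show ?thesis
    proof (cases "m < k")
      case True
      have "(\<lambda>i. (v(j := x)) (\<sigma> i)) = (\<lambda>i. v (\<sigma> i))(m := x)" for x
        by (auto simp: hit fun_eq_iff)
      moreover have "(\<lambda>i. (v(j := x)) (\<sigma> (k + i))) = (\<lambda>i. v (\<sigma> (k + i)))" for x
        using True by (auto simp: hit fun_eq_iff)
      moreover have "linear (\<lambda>x. \<alpha> ((\<lambda>i. v (\<sigma> i))(m := x)))"
        using \<alpha> True by (simp add: multilinear_form_def)
      ultimately show ?thesis
        using linear_compose_scale_right[of "\<lambda>x. \<alpha> ((\<lambda>i. v (\<sigma> i))(m := x))"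
            "of_int (sign \<sigma>) * \<beta> (\<lambda>i. v (\<sigma> (k + i)))"]
        by (simp only: real_scaleR_def mult.assoc mult.commute[of "\<alpha> _"])
    next
      case False
      have "\<alpha> (\<lambda>i. (v(j := x)) (\<sigma> i)) = \<alpha> (\<lambda>i. v (\<sigma> i))" for x
      proof -
        have "\<forall>i<k. (v(j := x)) (\<sigma> i) = v (\<sigma> i)"
          using False by (auto simp: hit)
        moreover have "\<alpha> u = \<alpha> w" if "\<forall>i<k. u i = w i" for u w
          using \<alpha> that by (simp add: multilinear_form_def)
        ultimately show ?thesis by simp
      qed
      moreover have "(\<lambda>i. (v(j := x)) (\<sigma> (k + i))) = (\<lambda>i. v (\<sigma> (k + i)))(m - k := x)" for x
        using False by (auto simp: hit fun_eq_iff)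
      moreover have "linear (\<lambda>x. \<beta> ((\<lambda>i. v (\<sigma> (k + i)))(m - k := x)))"
        using \<beta> False m by (simp add: multilinear_form_def)
      ultimately show ?thesis
        using linear_compose_scale_right[of "\<lambda>x. \<beta> ((\<lambda>i. v (\<sigma> (k + i)))(m - k := x))"
            "of_int (sign \<sigma>) * \<alpha> (\<lambda>i. v (\<sigma> i))"]
        by (simp only: real_scaleR_def mult.assoc)
    qed
  qed
  then have "linear (\<lambda>x. \<Sum>\<sigma> | \<sigma> permutes {..<k + l}. of_int (sign \<sigma>) *
      \<alpha> (\<lambda>i. (v(j := x)) (\<sigma> i)) * \<beta> (\<lambda>i. (v(j := x)) (\<sigma> (k + i))))"
    by (intro linear_compose_sum) auto
  from linear_compose_scale_right[OF this, of "1 / (fact k * fact l)"]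
  show "linear (\<lambda>x. wedge k l \<alpha> \<beta> (v(j := x)))"
    by (simp add: wedge_def field_simps)
qed

lemma annihilates_wedge:
  assumes "annihilates k z \<alpha>" "annihilates l z \<beta>"
  shows "annihilates (k + l) z (wedge k l \<alpha> \<beta>)"
  unfolding annihilates_def
proof (intro allI impI)
  fix v assume "\<exists>j<k + l. v j = z"
  then obtain j where j: "j < k + l" "v j = z" by blast
  have "\<alpha> (\<lambda>i. v (\<sigma> i)) * \<beta> (\<lambda>i. v (\<sigma> (k + i))) = 0" if \<sigma>: "\<sigma> permutes {..<k + l}" for \<sigma>
  proof -
    obtain m where m: "m < k + l" "\<sigma> m = j"
      using j permutes_image[OF \<sigma>] by (metis imageE lessThan_iff)
    show ?thesis
    proof (cases "m < k")
      case True
      then have "\<alpha> (\<lambda>i. v (\<sigma> i)) = 0"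
        using assms(1) m j by (auto simp: annihilates_def)
      then show ?thesis by simp
    next
      case False
      then have "m - k < l" "v (\<sigma> (k + (m - k))) = z" using m j by auto
      then have "\<beta> (\<lambda>i. v (\<sigma> (k + i))) = 0"
        using assms(2) by (auto simp: annihilates_def)
      then show ?thesis by simp
    qed
  qed
  then show "wedge k l \<alpha> \<beta> v = 0"
    unfolding wedge_def by (subst sum.neutral) (auto simp: mult.assoc)
qed

lemma multilinear_wedge_power2:
  "multilinear_form 2 \<omega> \<Longrightarrow> multilinear_form (2 * n) (wedge_power2 n \<omega>)"
proof (induction n)
  case (Suc n)
  from multilinear_wedge[OF Suc.prems Suc.IH[OF Suc.prems]] show ?case by simp
qed (simp add: multilinear_form_def)

lemma annihilates_wedge_power2:
  "annihilates 2 z \<omega> \<Longrightarrow> annihilates (2 * n) z (wedge_power2 n \<omega>)"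
proof (induction n)
  case (Suc n)
  from annihilates_wedge[OF Suc.prems Suc.IH[OF Suc.prems]] show ?case by simp
qed (simp add: annihilates_def)

text \<open>Composing with the transposition of two equal entries pairs each summand with its negative.\<close>

lemma wedge_alternating:
  assumes "i < k + l" "j < k + l" "i \<noteq> j" "v i = v j"
  shows "wedge k l \<alpha> \<beta> v = 0"
proof -
  define f where "f \<sigma> = of_int (sign \<sigma>) * \<alpha> (\<lambda>i. v (\<sigma> i)) * \<beta> (\<lambda>i. v (\<sigma> (k + i)))" for \<sigma>
  define \<tau> where "\<tau> = Transposition.transpose i j"
  have \<tau>: "\<tau> permutes {..<k + l}"
    using assms by (auto simp: \<tau>_def intro: permutes_swap_id)
  have v\<tau>: "v (\<tau> m) = v m" for m
    using assms(4) by (auto simp: \<tau>_def Transposition.transpose_def)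
  have "f (\<tau> \<circ> \<sigma>) = - f \<sigma>" if "\<sigma> permutes {..<k + l}" for \<sigma>
  proof -
    have "permutation \<tau>" "permutation \<sigma>"
      using permutes_imp_permutation[OF finite_lessThan] \<tau> that by blast+
    then have "sign (\<tau> \<circ> \<sigma>) = - sign \<sigma>"
      using assms(3) by (simp add: sign_compose) (simp add: \<tau>_def sign_swap_id)
    then show ?thesis by (simp add: f_def v\<tau>)
  qed
  then have "sum f {\<sigma>. \<sigma> permutes {..<k + l}} = - sum f {\<sigma>. \<sigma> permutes {..<k + l}}"
    by (subst setum_permutations_compose_left[OF \<tau>]) (simp add: sum_negf)
  then show ?thesis by (simp add: wedge_def f_def)
qed

text \<open>If the form is nonzero on \<open>v\<close>, then \<open>v\<close> is a basis. Replacing the \<open>j\<close>-th vector of \<open>v\<close> by \<open>z\<close>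
multiplies the value by the \<open>j\<close>-th coefficient of \<open>z\<close>, but makes it zero. For a contact form this says
that its kernel and the kernel of its derivative meet only in zero.\<close>

lemma wedge_top_degree_annihilated:
  fixes z :: "'e::euclidean_space"
  assumes \<alpha>: "multilinear_form k \<alpha>" "annihilates k z \<alpha>"
    and \<beta>: "multilinear_form l \<beta>" "annihilates l z \<beta>"
    and dim: "DIM('e) = k + l" and z: "z \<noteq> 0"
  shows "wedge k l \<alpha> \<beta> v = 0"
proof (rule ccontr)
  let ?F = "wedge k l \<alpha> \<beta>" and ?I = "{..<k + l}"
  assume nz: "?F v \<noteq> 0"
  have lin: "linear (\<lambda>x. ?F (v(j := x)))" if "j \<in> ?I" for j
    using multilinear_wedge[OF \<alpha>(1) \<beta>(1)] that by (simp add: multilinear_form_def)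
  have off: "?F (v(j := v i)) = 0" if "i \<in> ?I" "j \<in> ?I" "i \<noteq> j" for i j
    by (rule wedge_alternating[of i _ _ j]) (use that in auto)
  have notin: "v j \<notin> span (v ` (?I - {j}))" if j: "j \<in> ?I" for j
  proof
    assume "v j \<in> span (v ` (?I - {j}))"
    then have "?F (v(j := v j)) = 0"
      by (rule linear_eq_0_on_span[OF lin[OF j], rotated]) (use off j in blast)
    with nz show False by simp
  qed
  have inj: "inj_on v ?I"
  proof (rule inj_onI, rule ccontr)
    fix i j assume "i \<in> ?I" "j \<in> ?I" "v i = v j" "i \<noteq> j"
    then have "v j \<in> v ` (?I - {j})" by (metis DiffI image_eqI singletonD)
    from span_base[OF this] show False using notin[OF \<open>j \<in> ?I\<close>] by contradiction
  qed
  have "independent (v ` ?I)"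
    unfolding dependent_def
  proof
    assume "\<exists>a\<in>v ` ?I. a \<in> span (v ` ?I - {a})"
    then obtain j where "j \<in> ?I" "v j \<in> span (v ` ?I - {v j})" by blast
    moreover have "v ` ?I - {v j} \<subseteq> v ` (?I - {j})" by auto
    ultimately show False using notin[of j] span_mono by blast
  qed
  moreover have "card (v ` ?I) = DIM('e)"
    using inj dim by (simp add: card_image)
  ultimately have "UNIV \<subseteq> span (v ` ?I)"
    by (intro card_ge_dim_independent) auto
  then have "z \<in> span (v ` ?I)" by blast
  then obtain u where "z = (\<Sum>w\<in>v ` ?I. u w *\<^sub>R w)"
    unfolding span_finite[OF finite_imageI[OF finite_lessThan]] by blast
  then have zu: "z = (\<Sum>i\<in>?I. u (v i) *\<^sub>R v i)"
    using inj by (simp add: sum.reindex)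
  have "u (v j) = 0" if j: "j \<in> ?I" for j
  proof -
    have "?F (v(j := z)) = (\<Sum>i\<in>?I. u (v i) *\<^sub>R ?F (v(j := v i)))"
      unfolding zu by (simp only: linear_sum[OF lin[OF j]] linear_scale[OF lin[OF j]])
    also have "\<dots> = (\<Sum>i\<in>?I. if i = j then u (v j) * ?F v else 0)"
      using off j by (intro sum.cong) auto
    also have "\<dots> = u (v j) * ?F v"
      using j by simp
    finally have "?F (v(j := z)) = u (v j) * ?F v" .
    moreover have "?F (v(j := z)) = 0"
    proof -
      have "\<exists>i<k + l. (v(j := z)) i = z"
        using j by (intro exI[of _ j]) simp
      then show ?thesis
        using annihilates_wedge[OF \<alpha>(2) \<beta>(2)] unfolding annihilates_def by blast
    qed
    ultimately show ?thesis using nz by simp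
  qed
  with zu z show False by simp
qed

section \<open>Smooth functions and families of linear maps\<close>

text \<open>Schwarz's theorem. By the mean value theorem, applied twice, the second difference of \<open>f\<close> over the
parallelogram with sides \<open>s u\<close> and \<open>s v\<close> is \<open>s\<^sup>2\<close> times a value of the second derivative at a point
of the parallelogram, for either order of differentiation.\<close>

lemma mixed_second_derivatives_agree:
  fixes f :: "'a::real_normed_vector \<Rightarrow> 'b::euclidean_space"
  assumes S: "open S" "x \<in> S"
    and f: "\<And>y. y \<in> S \<Longrightarrow> (f has_derivative f' y) (at y)"
    and fu: "\<And>y. y \<in> S \<Longrightarrow> ((\<lambda>y. f' y u) has_derivative fu y) (at y)"
    and fv: "\<And>y. y \<in> S \<Longrightarrow> ((\<lambda>y. f' y v) has_derivative fv y) (at y)"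
    and cont: "continuous_on S (\<lambda>y. fu y v)" "continuous_on S (\<lambda>y. fv y u)"
  shows "fu x v = fv x u"
proof -
  \<comment> \<open>The functions and directions are generalised, so that \<open>key\<close> also covers the other order of differentiation.\<close>
  have key: "\<exists>\<sigma>\<in>{0..s}. \<exists>\<tau>\<in>{0..s}.
      (f (x + s *\<^sub>R u + s *\<^sub>R v) - f (x + s *\<^sub>R u) - f (x + s *\<^sub>R v) + f x) \<bullet> b
      = s * (s * (fu (x + \<sigma> *\<^sub>R u + \<tau> *\<^sub>R v) v \<bullet> b))"
    if r: "ball x r \<subseteq> S" and s: "0 < s" "s * (norm u + norm v) < r"
      and f: "\<And>y. y \<in> S \<Longrightarrow> (f has_derivative f' y) (at y)"
      and fu: "\<And>y. y \<in> S \<Longrightarrow> ((\<lambda>y. f' y u) has_derivative fu y) (at y)"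
    for f :: "'a \<Rightarrow> 'b" and f' fu u v b r s
  proof -
    have inS: "x + \<sigma> *\<^sub>R u + \<tau> *\<^sub>R v \<in> S" if "\<sigma> \<in> {0..s}" "\<tau> \<in> {0..s}" for \<sigma> \<tau>
    proof -
      have "norm (\<sigma> *\<^sub>R u + \<tau> *\<^sub>R v) \<le> \<sigma> * norm u + \<tau> * norm v"
        using that by (intro norm_triangle_le) simp
      also have "\<dots> \<le> s * norm u + s * norm v"
        using that by (intro add_mono mult_right_mono) auto
      also have "\<dots> < r" using s by (simp add: distrib_left)
      finally have "dist (x + (\<sigma> *\<^sub>R u + \<tau> *\<^sub>R v)) x < r" by (simp add: dist_norm)
      then have "x + (\<sigma> *\<^sub>R u + \<tau> *\<^sub>R v) \<in> ball x r" by (simp add: dist_commute)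
      with r show ?thesis by (auto simp: add.assoc)
    qed
    have "\<exists>\<sigma>. 0 < \<sigma> \<and> \<sigma> < s \<and>
        (f (x + s *\<^sub>R u + s *\<^sub>R v) - f (x + s *\<^sub>R u)) \<bullet> b - (f (x + 0 *\<^sub>R u + s *\<^sub>R v) - f (x + 0 *\<^sub>R u)) \<bullet> b
        = (s - 0) * ((f' (x + \<sigma> *\<^sub>R u + s *\<^sub>R v) u - f' (x + \<sigma> *\<^sub>R u + 0 *\<^sub>R v) u) \<bullet> b)"
    proof (rule MVT2[OF s(1)])
      fix \<sigma> assume "0 \<le> \<sigma>" "\<sigma> \<le> s"
      then have in1: "x + \<sigma> *\<^sub>R u + s *\<^sub>R v \<in> S" and in2: "x + \<sigma> *\<^sub>R u \<in> S"
        using inS[of \<sigma> s] inS[of \<sigma> 0] s by auto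
      have l: "linear (f' y)" if "y \<in> S" for y
        using f[OF that] by (rule has_derivative_linear)
      have d1: "((\<lambda>\<sigma>. f (x + \<sigma> *\<^sub>R u + s *\<^sub>R v)) has_derivative (\<lambda>h. f' (x + \<sigma> *\<^sub>R u + s *\<^sub>R v) (h *\<^sub>R u))) (at \<sigma>)"
        by (rule has_derivative_compose[where f = "\<lambda>\<sigma>. x + \<sigma> *\<^sub>R u + s *\<^sub>R v" and g = f, OF _ f[OF in1]]) (auto intro!: derivative_eq_intros)
      have d2: "((\<lambda>\<sigma>. f (x + \<sigma> *\<^sub>R u)) has_derivative (\<lambda>h. f' (x + \<sigma> *\<^sub>R u) (h *\<^sub>R u))) (at \<sigma>)"
        by (rule has_derivative_compose[where f = "\<lambda>\<sigma>. x + \<sigma> *\<^sub>R u" and g = f, OF _ f[OF in2]]) (auto intro!: derivative_eq_intros)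
      show "((\<lambda>\<sigma>. (f (x + \<sigma> *\<^sub>R u + s *\<^sub>R v) - f (x + \<sigma> *\<^sub>R u)) \<bullet> b) has_real_derivative
          ((f' (x + \<sigma> *\<^sub>R u + s *\<^sub>R v) u - f' (x + \<sigma> *\<^sub>R u + 0 *\<^sub>R v) u) \<bullet> b)) (at \<sigma>)"
        unfolding has_field_derivative_def
        by (rule has_derivative_eq_rhs[OF has_derivative_inner_left[OF has_derivative_diff[OF d1 d2]]])
          (simp add: fun_eq_iff linear_scale[OF l[OF in1]] linear_scale[OF l[OF in2]] inner_diff_left left_diff_distrib mult.commute[of _ "_ \<bullet> b"])
    qed
    then obtain \<sigma> where \<sigma>: "\<sigma> \<in> {0..s}" and eq1:
      "(f (x + s *\<^sub>R u + s *\<^sub>R v) - f (x + s *\<^sub>R u)) \<bullet> b - (f (x + s *\<^sub>R v) - f x) \<bullet> b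
        = s * ((f' (x + \<sigma> *\<^sub>R u + s *\<^sub>R v) u - f' (x + \<sigma> *\<^sub>R u + 0 *\<^sub>R v) u) \<bullet> b)"
      unfolding atLeastAtMost_iff by (metis add.right_neutral diff_zero less_imp_le scaleR_zero_left)
    have "\<exists>\<tau>. 0 < \<tau> \<and> \<tau> < s \<and>
        f' (x + \<sigma> *\<^sub>R u + s *\<^sub>R v) u \<bullet> b - f' (x + \<sigma> *\<^sub>R u + 0 *\<^sub>R v) u \<bullet> b
        = (s - 0) * (fu (x + \<sigma> *\<^sub>R u + \<tau> *\<^sub>R v) v \<bullet> b)"
    proof (rule MVT2[OF s(1)])
      fix \<tau> assume "0 \<le> \<tau>" "\<tau> \<le> s"
      then have in1: "x + \<sigma> *\<^sub>R u + \<tau> *\<^sub>R v \<in> S" using inS \<sigma> by auto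
      have l: "linear (fu (x + \<sigma> *\<^sub>R u + \<tau> *\<^sub>R v))"
        using fu[OF in1] by (rule has_derivative_linear)
      have d1: "((\<lambda>\<tau>. f' (x + \<sigma> *\<^sub>R u + \<tau> *\<^sub>R v) u) has_derivative (\<lambda>h. fu (x + \<sigma> *\<^sub>R u + \<tau> *\<^sub>R v) (h *\<^sub>R v))) (at \<tau>)"
        by (rule has_derivative_compose[where f = "\<lambda>\<tau>. x + \<sigma> *\<^sub>R u + \<tau> *\<^sub>R v" and g = "\<lambda>y. f' y u",
              OF _ fu[OF in1]]) (auto intro!: derivative_eq_intros)
      show "((\<lambda>\<tau>. f' (x + \<sigma> *\<^sub>R u + \<tau> *\<^sub>R v) u \<bullet> b) has_real_derivative
          (fu (x + \<sigma> *\<^sub>R u + \<tau> *\<^sub>R v) v \<bullet> b)) (at \<tau>)"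
        unfolding has_field_derivative_def
        by (rule has_derivative_eq_rhs[OF has_derivative_inner_left[OF d1]])
          (simp add: fun_eq_iff linear_scale[OF l])
    qed
    then obtain \<tau> where \<tau>: "\<tau> \<in> {0..s}" and eq2:
        "f' (x + \<sigma> *\<^sub>R u + s *\<^sub>R v) u \<bullet> b - f' (x + \<sigma> *\<^sub>R u + 0 *\<^sub>R v) u \<bullet> b
        = s * (fu (x + \<sigma> *\<^sub>R u + \<tau> *\<^sub>R v) v \<bullet> b)"
      unfolding atLeastAtMost_iff by (metis diff_zero less_imp_le)
    from eq1 eq2 \<sigma> \<tau> show ?thesis
      by (intro bexI[of _ \<sigma>] bexI[of _ \<tau>]) (auto simp: inner_diff_left inner_add_left)
  qed
  show ?thesis
  proof (rule euclidean_eqI)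
    fix b :: 'b assume "b \<in> Basis"
    show "fu x v \<bullet> b = fv x u \<bullet> b"
    proof (rule ccontr)
      assume ne: "fu x v \<bullet> b \<noteq> fv x u \<bullet> b"
      define e where "e = \<bar>fu x v \<bullet> b - fv x u \<bullet> b\<bar> / 2"
      have "e > 0" using ne by (simp add: e_def)
      have c: "continuous_on S (\<lambda>y. fu y v \<bullet> b)" "continuous_on S (\<lambda>y. fv y u \<bullet> b)"
        by (intro continuous_on_inner cont continuous_on_const)+
      obtain r1 where r1: "r1 > 0" "\<And>y. y \<in> S \<Longrightarrow> dist y x < r1 \<Longrightarrow> \<bar>fu y v \<bullet> b - fu x v \<bullet> b\<bar> < e"
        using c(1)[unfolded continuous_on_iff dist_real_def, rule_format, OF S(2) \<open>e > 0\<close>] by blast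
      obtain r2 where r2: "r2 > 0" "\<And>y. y \<in> S \<Longrightarrow> dist y x < r2 \<Longrightarrow> \<bar>fv y u \<bullet> b - fv x u \<bullet> b\<bar> < e"
        using c(2)[unfolded continuous_on_iff dist_real_def, rule_format, OF S(2) \<open>e > 0\<close>] by blast
      obtain r3 where r3: "r3 > 0" "ball x r3 \<subseteq> S"
        using S open_contains_ball by blast
      define r where "r = min r1 (min r2 r3)"
      have "r > 0" using r1 r2 r3 by (simp add: r_def)
      have ball: "ball x r \<subseteq> S" using r3 by (auto simp: r_def)
      define s where "s = r / (norm u + norm v + 1)"
      have nn: "norm u + norm v + 1 > 0"
        by (simp add: add_nonneg_pos)
      have "s > 0" using \<open>r > 0\<close> nn by (simp add: s_def)
      have sr: "s * (norm u + norm v) < r"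
      proof -
        have "s * (norm u + norm v) < s * (norm u + norm v + 1)"
          using \<open>s > 0\<close> by simp
        also have "\<dots> = r" using nn by (simp add: s_def)
        finally show ?thesis .
      qed
      have near: "dist (x + \<sigma> *\<^sub>R u + \<tau> *\<^sub>R v) x < r" if "\<sigma> \<in> {0..s}" "\<tau> \<in> {0..s}" for \<sigma> \<tau>
      proof -
        have "norm (\<sigma> *\<^sub>R u + \<tau> *\<^sub>R v) \<le> \<sigma> * norm u + \<tau> * norm v"
          using that by (intro norm_triangle_le) simp
        also have "\<dots> \<le> s * norm u + s * norm v"
          using that by (intro add_mono mult_right_mono) auto
        also have "\<dots> < r" using sr by (simp add: distrib_left)
        finally show ?thesis by (simp add: dist_norm add.assoc)
      qed
      obtain \<sigma> \<tau> where st: "\<sigma> \<in> {0..s}" "\<tau> \<in> {0..s}"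
        "(f (x + s *\<^sub>R u + s *\<^sub>R v) - f (x + s *\<^sub>R u) - f (x + s *\<^sub>R v) + f x) \<bullet> b
          = s * (s * (fu (x + \<sigma> *\<^sub>R u + \<tau> *\<^sub>R v) v \<bullet> b))"
        using key[OF ball \<open>s > 0\<close> sr f fu, of b] by blast
      obtain \<sigma>' \<tau>' where st': "\<sigma>' \<in> {0..s}" "\<tau>' \<in> {0..s}"
        "(f (x + s *\<^sub>R v + s *\<^sub>R u) - f (x + s *\<^sub>R v) - f (x + s *\<^sub>R u) + f x) \<bullet> b
          = s * (s * (fv (x + \<sigma>' *\<^sub>R v + \<tau>' *\<^sub>R u) u \<bullet> b))"
        using key[OF ball \<open>s > 0\<close> sr[unfolded add.commute[of "norm u"]] f fv, of b] by blast
      have "fu (x + \<sigma> *\<^sub>R u + \<tau> *\<^sub>R v) v \<bullet> b = fv (x + \<sigma>' *\<^sub>R v + \<tau>' *\<^sub>R u) u \<bullet> b"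
        using st(3) st'(3) \<open>s > 0\<close> by (simp add: algebra_simps)
      moreover have "\<bar>fu (x + \<sigma> *\<^sub>R u + \<tau> *\<^sub>R v) v \<bullet> b - fu x v \<bullet> b\<bar> < e"
        using near[OF st(1,2)] ball by (intro r1) (auto simp: r_def dist_commute subset_iff)
      moreover have "\<bar>fv (x + \<sigma>' *\<^sub>R v + \<tau>' *\<^sub>R u) u \<bullet> b - fv x u \<bullet> b\<bar> < e"
        using near[OF st'(2,1)] ball
        by (intro r2) (auto simp: r_def dist_commute subset_iff add.assoc add.commute[of "\<sigma>' *\<^sub>R v"])
      ultimately show False unfolding e_def by (smt (verit) field_sum_of_halves)
    qed
  qed
qed

lemma smooth_on_has_derivative:
  "smooth_on S f \<Longrightarrow> x \<in> S \<Longrightarrow> (f has_derivative frechet_derivative f (at x)) (at x)"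
  unfolding smooth_on_def frechet_derivative_works[symmetric] by (metis Ck_on.simps(2))

lemma smooth_on_derivative:
  "smooth_on S f \<Longrightarrow> smooth_on S (\<lambda>x. frechet_derivative f (at x) v)"
  unfolding smooth_on_def by (metis Ck_on.simps(2))

lemma smooth_on_continuous: "smooth_on S f \<Longrightarrow> continuous_on S f"
  unfolding smooth_on_def by (metis Ck_on.simps(1))

lemma smooth_on_second_derivative_commute:
  fixes f :: "'e::euclidean_space \<Rightarrow> 'f::euclidean_space"
  assumes f: "smooth_on S f" and x: "x \<in> S"
  shows "frechet_derivative (\<lambda>y. frechet_derivative f (at y) u) (at x) v
       = frechet_derivative (\<lambda>y. frechet_derivative f (at y) v) (at x) u"
proof (rule mixed_second_derivatives_agree[where S = S])
  show "open S" using f by (simp add: smooth_on_def)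
qed (use x f in \<open>auto intro: smooth_on_has_derivative smooth_on_derivative smooth_on_continuous\<close>)

lemma derivative_of_linear_family_linear:
  fixes B :: "'e::real_normed_vector \<Rightarrow> 'v::real_vector \<Rightarrow> 'f::real_normed_vector"
  assumes S: "open S" "x \<in> S" and lin: "\<And>y. y \<in> S \<Longrightarrow> linear (B y)"
    and B: "\<And>w. ((\<lambda>y. B y w) has_derivative (\<lambda>u. B' u w)) (at x)"
  shows "linear (B' u)"
proof (rule linearI)
  fix v w and c :: real
  have "((\<lambda>y. B y (v + w)) has_derivative (\<lambda>u. B' u v + B' u w)) (at x)"
    by (rule has_derivative_transform_within_open[OF has_derivative_add[OF B B] S])
      (simp add: lin linear_add)
  from has_derivative_unique[OF B this] show "B' u (v + w) = B' u v + B' u w"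
    by (metis (no_types))
  have "((\<lambda>y. B y (c *\<^sub>R v)) has_derivative (\<lambda>u. c *\<^sub>R B' u v)) (at x)"
    by (rule has_derivative_transform_within_open[OF has_derivative_scaleR_right[OF B] S])
      (simp add: lin linear_scale)
  from has_derivative_unique[OF B this] show "B' u (c *\<^sub>R v) = c *\<^sub>R B' u v"
    by (metis (no_types))
qed

text \<open>The product rule for a field of linear maps applied to a vector field. Differentiability of the field
of maps is only required of its values at constant vectors.\<close>

lemma has_derivative_linear_family:
  fixes B :: "'e::real_normed_vector \<Rightarrow> 'v::euclidean_space \<Rightarrow> 'f::real_normed_vector"
  assumes S: "open S" "x \<in> S" and lin: "\<And>y. y \<in> S \<Longrightarrow> linear (B y)"
    and B: "\<And>w. ((\<lambda>y. B y w) has_derivative (\<lambda>u. B' u w)) (at x)"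
    and f: "(f has_derivative f') (at x)"
  shows "((\<lambda>y. B y (f y)) has_derivative (\<lambda>u. B' u (f x) + B x (f' u))) (at x)"
proof -
  have expand: "L w = (\<Sum>b\<in>Basis. (w \<bullet> b) *\<^sub>R L b)" if "linear L" for L :: "'v \<Rightarrow> 'f" and w
    by (subst euclidean_representation[of w, symmetric])
      (simp only: linear_sum[OF that] linear_scale[OF that])
  have "((\<lambda>y. \<Sum>b\<in>Basis. (f y \<bullet> b) *\<^sub>R B y b) has_derivative
      (\<lambda>u. \<Sum>b\<in>Basis. (f x \<bullet> b) *\<^sub>R B' u b + (f' u \<bullet> b) *\<^sub>R B x b)) (at x)"
    by (intro has_derivative_sum has_derivative_scaleR has_derivative_inner_left f B)
  moreover have "(\<Sum>b\<in>Basis. (f x \<bullet> b) *\<^sub>R B' u b + (f' u \<bullet> b) *\<^sub>R B x b) = B' u (f x) + B x (f' u)" for u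
  proof -
    have "linear (B' u)"
      by (rule derivative_of_linear_family_linear[OF S lin B])
    from expand[OF this, of "f x"] expand[OF lin[OF S(2)], of "f' u"]
    show ?thesis by (simp add: sum.distrib)
  qed
  ultimately have "((\<lambda>y. \<Sum>b\<in>Basis. (f y \<bullet> b) *\<^sub>R B y b) has_derivative
      (\<lambda>u. B' u (f x) + B x (f' u))) (at x)"
    by simp
  then show ?thesis
    by (rule has_derivative_transform_within_open[OF _ S]) (rule expand[OF lin, symmetric])
qed

section \<open>Curvature and contact forms in a left invariant frame\<close>

text \<open>The coordinate data of a metric and a frame of left invariant fields \<open>E a\<close>, with first and second
derivatives \<open>DE\<close> and \<open>D2E\<close>. Left invariance enters through the constant inner products and the
constant structure map \<open>br\<close> of the Lie bracket of vector fields in \<open>E_bracket\<close>.\<close>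

locale left_invariant_frame =
  fixes S :: "'e::euclidean_space set" and g :: "'e \<Rightarrow> 'e \<Rightarrow> 'e \<Rightarrow> real"
    and E :: "'e \<Rightarrow> 'e \<Rightarrow> 'e" and DE :: "'e \<Rightarrow> 'e \<Rightarrow> 'e \<Rightarrow> 'e"
    and D2E :: "'e \<Rightarrow> 'e \<Rightarrow> 'e \<Rightarrow> 'e \<Rightarrow> 'e" and br :: "'e \<Rightarrow> 'e \<Rightarrow> 'e" and x0 :: 'e
  assumes open_S: "open S" and x0: "x0 \<in> S"
    and g_bilinear: "x \<in> S \<Longrightarrow> bilinear (g x)"
    and g_commute: "x \<in> S \<Longrightarrow> g x v w = g x w v"
    and g_pos: "x \<in> S \<Longrightarrow> v \<noteq> 0 \<Longrightarrow> g x v v > 0"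
    and g_differentiable: "x \<in> S \<Longrightarrow> (\<lambda>y. g y v w) differentiable (at x)"
    and E_linear: "x \<in> S \<Longrightarrow> linear (E x)"
    and E_deriv: "x \<in> S \<Longrightarrow> ((\<lambda>y. E y a) has_derivative (\<lambda>u. DE x u a)) (at x)"
    and DE_deriv: "x \<in> S \<Longrightarrow> ((\<lambda>y. DE y u a) has_derivative (\<lambda>v. D2E x v u a)) (at x)"
    and D2E_commute: "x \<in> S \<Longrightarrow> D2E x v u a = D2E x u v a"
    and E_orthonormal: "x \<in> S \<Longrightarrow> g x (E x a) (E x b) = a \<bullet> b"
    and E_bracket: "x \<in> S \<Longrightarrow> DE x (E x a) b - DE x (E x b) a = E x (br a b)"
begin

text \<open>The inverse of \<open>E x\<close>, written by means of orthonormality so that it is visibly differentiable.\<close>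

definition coframe :: "'e \<Rightarrow> 'e \<Rightarrow> 'e" where
  "coframe x u = (\<Sum>b\<in>Basis. g x u (E x b) *\<^sub>R b)"

lemma g_linear: "x \<in> S \<Longrightarrow> linear (g x v)" "x \<in> S \<Longrightarrow> linear (\<lambda>v. g x v w)"
  using g_bilinear by (auto simp: bilinear_def)

lemma coframe_linear: "x \<in> S \<Longrightarrow> linear (coframe x)"
  unfolding coframe_def
  by (auto intro!: linearI simp: linear_add[OF g_linear(2)] linear_scale[OF g_linear(2)]
      scaleR_add_left sum.distrib scaleR_sum_right)

lemma coframe_E: "x \<in> S \<Longrightarrow> coframe x (E x a) = a"
  by (simp add: coframe_def E_orthonormal euclidean_representation)

lemma E_coframe: "x \<in> S \<Longrightarrow> E x (coframe x u) = u"
proof -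
  assume x: "x \<in> S"
  have "inj (E x)" using coframe_E[OF x] by (metis injI)
  then have "surj (E x)" using linear_injective_imp_surjective[OF E_linear[OF x]] by simp
  then obtain a where "u = E x a" by blast
  then show ?thesis using coframe_E[OF x] by simp
qed

lemma DE_linear: "x \<in> S \<Longrightarrow> linear (DE x u)" "x \<in> S \<Longrightarrow> linear (\<lambda>u. DE x u a)"
  using derivative_of_linear_family_linear[OF open_S _ E_linear E_deriv]
    has_derivative_linear[OF E_deriv] by blast+

lemmas DE_simps = linear_add[OF DE_linear(1)] linear_add[OF DE_linear(2)]
  linear_scale[OF DE_linear(1)] linear_scale[OF DE_linear(2)]

lemma br_eq: "br a b = coframe x0 (DE x0 (E x0 a) b - DE x0 (E x0 b) a)"
  by (simp add: E_bracket x0 coframe_E)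

lemma br_linear: "linear (br a)" "linear (\<lambda>a. br a b)"
  unfolding br_eq
  using x0 by (auto intro!: linearI simp: linear_diff linear_add linear_scale coframe_linear
      DE_simps E_linear algebra_simps)

lemmas br_simps = linear_add[OF br_linear(1)] linear_add[OF br_linear(2)]
  linear_scale[OF br_linear(1)] linear_scale[OF br_linear(2)]

lemma br_skew: "br a b = - br b a"
  by (simp add: br_eq linear_diff[OF coframe_linear[OF x0]])

text \<open>The derivative of an inverse, found by differentiating \<open>E_coframe\<close>.\<close>

lemma coframe_deriv:
  assumes x: "x \<in> S"
  shows "((\<lambda>y. coframe y u) has_derivative (\<lambda>v. - coframe x (DE x v (coframe x u)))) (at x)"
proof -
  define T where "T v = (\<Sum>b\<in>Basis. (frechet_derivative (\<lambda>y. g y u (E x b)) (at x) v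
    + g x u (DE x v b)) *\<^sub>R b)" for v
  have T: "((\<lambda>y. coframe y u) has_derivative T) (at x)"
    unfolding coframe_def T_def
  proof (intro has_derivative_sum has_derivative_scaleR_left)
    fix b :: 'e
    show "((\<lambda>y. g y u (E y b)) has_derivative
        (\<lambda>v. frechet_derivative (\<lambda>y. g y u (E x b)) (at x) v + g x u (DE x v b))) (at x)"
      by (rule has_derivative_linear_family[OF open_S x g_linear(1) _ E_deriv[OF x]])
        (use g_differentiable[OF x] frechet_derivative_works in auto)
  qed
  have "((\<lambda>y. E y (coframe y u)) has_derivative (\<lambda>v. DE x v (coframe x u) + E x (T v))) (at x)"
    by (rule has_derivative_linear_family[OF open_S x E_linear E_deriv[OF x] T])
  then have "((\<lambda>y. u) has_derivative (\<lambda>v. DE x v (coframe x u) + E x (T v))) (at x)"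
    by (rule has_derivative_transform_within_open[OF _ open_S x]) (rule E_coframe)
  from has_derivative_unique[OF this has_derivative_const]
  have "E x (T v) = - DE x v (coframe x u)" for v
    by (metis add_eq_0_iff)
  then have "coframe x (E x (T v)) = - coframe x (DE x v (coframe x u))" for v
    by (simp add: linear_neg[OF coframe_linear[OF x]])
  then have "T = (\<lambda>v. - coframe x (DE x v (coframe x u)))"
    by (simp add: coframe_E[OF x] fun_eq_iff)
  with T show ?thesis by simp
qed

text \<open>Koszul's formula on left invariant fields, where the derivatives of inner products drop out.\<close>

definition N :: "'e \<Rightarrow> 'e \<Rightarrow> 'e" where
  "N a b = (\<Sum>z\<in>Basis. ((br a b \<bullet> z - br b z \<bullet> a + br z a \<bullet> b) / 2) *\<^sub>R z)"

lemma inner_N: "N a b \<bullet> z = (br a b \<bullet> z - br b z \<bullet> a + br z a \<bullet> b) / 2"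
proof -
  define L where "L z = (br a b \<bullet> z - br b z \<bullet> a + br z a \<bullet> b) / 2" for z
  have lin: "linear L"
    by (auto intro!: linearI simp: L_def br_simps inner_add_left inner_add_right field_simps)
  have "N a b \<bullet> z = (\<Sum>k\<in>Basis. L k * (k \<bullet> z))"
    by (simp add: N_def L_def inner_sum_left)
  also have "\<dots> = (\<Sum>k\<in>Basis. (z \<bullet> k) *\<^sub>R L k)"
    by (simp add: inner_commute mult.commute)
  also have "\<dots> = L (\<Sum>k\<in>Basis. (z \<bullet> k) *\<^sub>R k)"
    by (simp only: linear_sum[OF lin] linear_scale[OF lin])
  also have "\<dots> = L z"
    by (simp only: euclidean_representation)
  finally show ?thesis by (simp add: L_def)
qed

lemma bilinear_N: "bilinear N"
  unfolding bilinear_def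
proof (intro conjI allI linearI)
  fix a b c :: 'e and r :: real
  show "N a (b + c) = N a b + N a c" "N (b + c) a = N b a + N c a"
    "N a (r *\<^sub>R b) = r *\<^sub>R N a b" "N (r *\<^sub>R b) a = r *\<^sub>R N b a"
    by (rule euclidean_eqI;
        simp add: inner_N inner_add_left inner_add_right br_simps field_simps)+
qed

lemma N_skew: "N a b \<bullet> c = - (b \<bullet> N a c)"
  using br_skew[of a b] br_skew[of b c] br_skew[of c a]
  by (simp add: inner_N inner_commute[of b "N a c"] inner_diff_left inner_minus_left field_simps)

lemma N_torsion: "N a b - N b a = br a b"
proof (rule euclidean_eqI)
  fix z :: 'e
  show "(N a b - N b a) \<bullet> z = br a b \<bullet> z"
    using br_skew[of a b] br_skew[of b z] br_skew[of z a]
    by (simp add: inner_N inner_diff_left inner_minus_left field_simps)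
qed

text \<open>The connection \<open>N\<close> transformed from the frame to coordinates; it will turn out to be the
Christoffel symbol.\<close>

definition \<Gamma> :: "'e \<Rightarrow> 'e \<Rightarrow> 'e \<Rightarrow> 'e" where
  "\<Gamma> x u v = E x (N (coframe x u) (coframe x v)) - DE x u (coframe x v)"

lemma \<Gamma>_linear:
  assumes x: "x \<in> S"
  shows "linear (\<Gamma> x u)"
  unfolding \<Gamma>_def
  by (auto intro!: linearI simp: linear_add linear_scale coframe_linear x E_linear DE_simps
      bilinear_ladd[OF bilinear_N] bilinear_radd[OF bilinear_N]
      bilinear_lmul[OF bilinear_N] bilinear_rmul[OF bilinear_N] scaleR_diff_right)

lemma \<Gamma>_E: "x \<in> S \<Longrightarrow> \<Gamma> x u (E x a) = E x (N (coframe x u) a) - DE x u a"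
  by (simp add: \<Gamma>_def coframe_E)

lemma \<Gamma>_commute:
  assumes x: "x \<in> S"
  shows "\<Gamma> x u v = \<Gamma> x v u"
proof -
  have "E x (br (coframe x u) (coframe x v)) = DE x u (coframe x v) - DE x v (coframe x u)"
    using E_bracket[OF x, of "coframe x u" "coframe x v"] by (simp add: E_coframe x)
  then show ?thesis
    by (simp add: \<Gamma>_def N_torsion[symmetric] linear_diff[OF E_linear[OF x]] algebra_simps)
qed

text \<open>Differentiate the constant inner product of two frame fields, and use that \<open>N\<close> is skew.\<close>

lemma \<Gamma>_metric:
  assumes x: "x \<in> S"
  shows "frechet_derivative (\<lambda>y. g y v w) (at x) u = g x (\<Gamma> x u v) w + g x v (\<Gamma> x u w)"
proof -
  define dg where "dg u v w = frechet_derivative (\<lambda>y. g y v w) (at x) u" for u v w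
  have dg: "((\<lambda>y. g y v w) has_derivative (\<lambda>u. dg u v w)) (at x)" for v w
    using g_differentiable[OF x] frechet_derivative_works unfolding dg_def by blast
  define a b where "a = coframe x v" and "b = coframe x w"
  have v: "v = E x a" and w: "w = E x b" by (simp_all add: a_def b_def E_coframe x)
  have d1: "((\<lambda>y. g y (E y a) w) has_derivative (\<lambda>u. dg u (E x a) w + g x (DE x u a) w)) (at x)" for w
    by (rule has_derivative_linear_family[OF open_S x g_linear(2) dg E_deriv[OF x]])
  have "((\<lambda>y. g y (E y a) (E y b)) has_derivative
      (\<lambda>u. (dg u (E x a) (E x b) + g x (DE x u a) (E x b)) + g x (E x a) (DE x u b))) (at x)"
    by (rule has_derivative_linear_family[OF open_S x g_linear(1) d1 E_deriv[OF x]])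
  then have "((\<lambda>y. a \<bullet> b) has_derivative
      (\<lambda>u. (dg u (E x a) (E x b) + g x (DE x u a) (E x b)) + g x (E x a) (DE x u b))) (at x)"
    by (rule has_derivative_transform_within_open[OF _ open_S x]) (rule E_orthonormal)
  from has_derivative_unique[OF this has_derivative_const]
  have "dg u (E x a) (E x b) + g x (DE x u a) (E x b) + g x (E x a) (DE x u b) = 0"
    by metis
  moreover have "g x (E x (N (coframe x u) a)) (E x b) + g x (E x a) (E x (N (coframe x u) b)) = 0"
    using N_skew[of "coframe x u" a b] by (simp add: E_orthonormal x)
  ultimately show ?thesis
    unfolding dg_def[symmetric] v w
    by (simp add: \<Gamma>_E x linear_diff[OF g_linear(1)[OF x]] linear_diff[OF g_linear(2)[OF x]])
qed

text \<open>A symmetric metric connection satisfies Koszul's formula.\<close>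

lemma christoffel_eq:
  assumes x: "x \<in> S"
  shows "christoffel g x u v = \<Gamma> x u v"
  unfolding christoffel_def
proof (rule the_equality)
  show koszul: "\<forall>w. g x (\<Gamma> x u v) w = (frechet_derivative (\<lambda>y. g y v w) (at x) u +
      frechet_derivative (\<lambda>y. g y u w) (at x) v - frechet_derivative (\<lambda>y. g y u v) (at x) w) / 2"
  proof
    fix w
    show "g x (\<Gamma> x u v) w = (frechet_derivative (\<lambda>y. g y v w) (at x) u +
      frechet_derivative (\<lambda>y. g y u w) (at x) v - frechet_derivative (\<lambda>y. g y u v) (at x) w) / 2"
      unfolding \<Gamma>_metric[OF x] \<Gamma>_commute[OF x, of v u] \<Gamma>_commute[OF x, of w u]
        \<Gamma>_commute[OF x, of w v] g_commute[OF x, of v "\<Gamma> x u w"] g_commute[OF x, of u "\<Gamma> x v w"]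
      by simp
  qed
  fix z assume "\<forall>w. g x z w = (frechet_derivative (\<lambda>y. g y v w) (at x) u +
      frechet_derivative (\<lambda>y. g y u w) (at x) v - frechet_derivative (\<lambda>y. g y u v) (at x) w) / 2"
  with koszul have "g x z w = g x (\<Gamma> x u v) w" for w
    by metis
  then have "g x (z - \<Gamma> x u v) (z - \<Gamma> x u v) = 0"
    by (simp only: linear_diff[OF g_linear(2)[OF x]] diff_self)
  with g_pos[OF x, of "z - \<Gamma> x u v"] show "z = \<Gamma> x u v" by fastforce
qed

definition d\<Gamma> :: "'e \<Rightarrow> 'e \<Rightarrow> 'e \<Rightarrow> 'e \<Rightarrow> 'e" where
  "d\<Gamma> x u v w = frechet_derivative (\<lambda>y. \<Gamma> y v w) (at x) u"

lemma \<Gamma>_deriv: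
  assumes x: "x \<in> S"
  shows "((\<lambda>y. \<Gamma> y v w) has_derivative (\<lambda>u. d\<Gamma> x u v w)) (at x)"
proof -
  have "\<exists>D. ((\<lambda>y. N (coframe y v) (coframe y w)) has_derivative D) (at x)"
    using bounded_bilinear.FDERIV[OF bilinear_N[unfolded bilinear_conv_bounded_bilinear]
        coframe_deriv[OF x] coframe_deriv[OF x]] by blast
  then obtain D where D: "((\<lambda>y. N (coframe y v) (coframe y w)) has_derivative D) (at x)" ..
  have "((\<lambda>y. E y (N (coframe y v) (coframe y w))) has_derivative
      (\<lambda>u. DE x u (N (coframe x v) (coframe x w)) + E x (D u))) (at x)"
    by (rule has_derivative_linear_family[OF open_S x E_linear E_deriv[OF x] D])
  moreover have "((\<lambda>y. DE y v (coframe y w)) has_derivative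
      (\<lambda>u. D2E x u v (coframe x w) + DE x v (- coframe x (DE x u (coframe x w))))) (at x)"
    by (rule has_derivative_linear_family[OF open_S x DE_linear(1) DE_deriv[OF x] coframe_deriv[OF x]])
  ultimately have "(\<lambda>y. \<Gamma> y v w) differentiable (at x)"
    unfolding \<Gamma>_def by (intro differentiable_diff) (blast intro: differentiableI)+
  then show ?thesis
    unfolding d\<Gamma>_def frechet_derivative_works .
qed

lemma d\<Gamma>_commute: "x \<in> S \<Longrightarrow> d\<Gamma> x u v w = d\<Gamma> x u w v"
proof -
  assume x: "x \<in> S"
  have "((\<lambda>y. \<Gamma> y v w) has_derivative (\<lambda>u. d\<Gamma> x u w v)) (at x)"
    by (rule has_derivative_transform_within_open[OF \<Gamma>_deriv[OF x] open_S x]) (rule \<Gamma>_commute)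
  from has_derivative_unique[OF \<Gamma>_deriv[OF x] this] show ?thesis by metis
qed

text \<open>Obtained by differentiating \<open>\<Gamma>_E\<close>, which avoids second derivatives of the coframe.\<close>

lemma d\<Gamma>_E:
  assumes x: "x \<in> S"
  shows "d\<Gamma> x u v (E x a) = DE x u (N (coframe x v) a)
    - E x (N (coframe x (DE x u (coframe x v))) a) - D2E x u v a - \<Gamma> x v (DE x u a)"
proof -
  have 1: "((\<lambda>y. N (coframe y v) a) has_derivative
      (\<lambda>u. N (- coframe x (DE x u (coframe x v))) a)) (at x)"
    by (rule bounded_linear.has_derivative[OF _ coframe_deriv[OF x]])
      (use bilinear_N in \<open>simp add: bilinear_def linear_conv_bounded_linear\<close>)
  have "((\<lambda>y. E y (N (coframe y v) a)) has_derivative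
      (\<lambda>u. DE x u (N (coframe x v) a) + E x (N (- coframe x (DE x u (coframe x v))) a))) (at x)"
    by (rule has_derivative_linear_family[OF open_S x E_linear E_deriv[OF x] 1])
  then have "((\<lambda>y. E y (N (coframe y v) a) - DE y v a) has_derivative
      (\<lambda>u. DE x u (N (coframe x v) a) + E x (N (- coframe x (DE x u (coframe x v))) a) - D2E x u v a)) (at x)"
    by (rule has_derivative_diff) (rule DE_deriv[OF x])
  then have lhs: "((\<lambda>y. \<Gamma> y v (E y a)) has_derivative
      (\<lambda>u. DE x u (N (coframe x v) a) + E x (N (- coframe x (DE x u (coframe x v))) a) - D2E x u v a)) (at x)"
    by (rule has_derivative_transform_within_open[OF _ open_S x]) (simp add: \<Gamma>_E)
  have rhs: "((\<lambda>y. \<Gamma> y v (E y a)) has_derivative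
      (\<lambda>u. d\<Gamma> x u v (E x a) + \<Gamma> x v (DE x u a))) (at x)"
    by (rule has_derivative_linear_family[OF open_S x \<Gamma>_linear \<Gamma>_deriv[OF x] E_deriv[OF x]])
  have "DE x u (N (coframe x v) a) + E x (N (- coframe x (DE x u (coframe x v))) a) - D2E x u v a
      = d\<Gamma> x u v (E x a) + \<Gamma> x v (DE x u a)"
    by (rule fun_cong[OF has_derivative_unique[OF lhs rhs], of u])
  then show ?thesis
    by (simp add: bilinear_lneg[OF bilinear_N] linear_neg[OF E_linear[OF x]] algebra_simps)
qed

text \<open>The curvature of the connection \<open>N\<close> on left invariant fields.\<close>

definition K :: "'e \<Rightarrow> 'e \<Rightarrow> 'e \<Rightarrow> 'e" where
  "K a b c = N a (N b c) - N b (N a c) - N (br a b) c"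

lemma riemann_curvature_\<Gamma>:
  assumes x: "x \<in> S"
  shows "riemann_curvature g x u v w =
    d\<Gamma> x u v w - d\<Gamma> x v u w + \<Gamma> x u (\<Gamma> x v w) - \<Gamma> x v (\<Gamma> x u w)"
proof -
  have "frechet_derivative (\<lambda>y. christoffel g y v w) (at x) u = d\<Gamma> x u v w" for u v w
  proof -
    have "((\<lambda>y. christoffel g y v w) has_derivative (\<lambda>u. d\<Gamma> x u v w)) (at x)"
      by (rule has_derivative_transform_within_open[OF \<Gamma>_deriv[OF x] open_S x])
        (simp add: christoffel_eq)
    from fun_cong[OF frechet_derivative_at[OF this], of u] show ?thesis by simp
  qed
  then show ?thesis by (simp add: riemann_curvature_def christoffel_eq x)
qed

text \<open>The curvature is a tensor: the second derivatives of the frame cancel by their symmetry, and the first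
derivatives of the coframe combine to the bracket (the Maurer-Cartan equation).\<close>

lemma riemann_curvature_frame:
  assumes x: "x \<in> S"
  shows "riemann_curvature g x (E x a) (E x b) (E x c) = E x (K a b c)"
proof -
  have br: "br a b = coframe x (DE x (E x a) b) - coframe x (DE x (E x b) a)"
    using coframe_E[OF x, of "br a b"] E_bracket[OF x, of a b, symmetric]
    by (simp add: linear_diff[OF coframe_linear[OF x]])
  show ?thesis
    unfolding riemann_curvature_\<Gamma>[OF x] d\<Gamma>_E[OF x] K_def br
    by (simp add: \<Gamma>_E x coframe_E D2E_commute[OF x, of "E x a"]
        linear_diff[OF E_linear[OF x]] linear_add[OF E_linear[OF x]] linear_diff[OF \<Gamma>_linear[OF x]]
        bilinear_lsub[OF bilinear_N] algebra_simps)
qed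

lemma K_skew12: "K a b c = - K b a c"
  using br_skew[of a b] by (simp add: K_def bilinear_lneg[OF bilinear_N])

lemma K_skew34: "K a b c \<bullet> d = - (K a b d \<bullet> c)"
  using N_skew[of a "N b c" d] N_skew[of b c "N a d"] N_skew[of b "N a c" d] N_skew[of a c "N b d"]
    N_skew[of "br a b" c d] inner_commute[of c "N b (N a d)"] inner_commute[of c "N a (N b d)"]
    inner_commute[of c "N (br a b) d"]
  unfolding K_def inner_diff_left by linarith

text \<open>In coordinates the first Bianchi identity is immediate from the symmetry of \<open>\<Gamma>\<close>. Working with \<open>K\<close>
alone would require the Jacobi identity for \<open>br\<close>.\<close>

lemma K_bianchi: "K a b c + K b c a + K c a b = 0"
proof -
  note x = x0
  have "riemann_curvature g x0 u v w + riemann_curvature g x0 v w u + riemann_curvature g x0 w u v = 0"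
    for u v w
    unfolding riemann_curvature_\<Gamma>[OF x] \<Gamma>_commute[OF x, of v u] \<Gamma>_commute[OF x, of w v]
      \<Gamma>_commute[OF x, of w u] d\<Gamma>_commute[OF x, of w v u] d\<Gamma>_commute[OF x, of u w v]
      d\<Gamma>_commute[OF x, of v w u]
    by simp
  from this[of "E x0 a" "E x0 b" "E x0 c"]
  have "E x0 (K a b c + K b c a + K c a b) = 0"
    by (simp add: riemann_curvature_frame[OF x] linear_add[OF E_linear[OF x]])
  then have "coframe x0 (E x0 (K a b c + K b c a + K c a b)) = 0"
    using linear_0[OF coframe_linear[OF x]] by metis
  then show ?thesis by (simp add: coframe_E x)
qed

lemma K_linear: "K (a + a') b c = K a b c + K a' b c" "K a b (c + c') = K a b c + K a b c'"
  "K a (r *\<^sub>R b) c = r *\<^sub>R K a b c"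
  by (simp_all add: K_def bilinear_ladd[OF bilinear_N] bilinear_radd[OF bilinear_N]
      bilinear_lmul[OF bilinear_N] bilinear_rmul[OF bilinear_N]
      br_simps algebra_simps)

text \<open>If \<open>a\<close> and \<open>b\<close> are dependent, the claim is trivial by skewness; otherwise it is the hypothesis for the
plane spanned by the corresponding frame fields.\<close>

lemma K_sectional:
  assumes flat: "\<And>u v. u \<noteq> v \<Longrightarrow> independent {u, v} \<Longrightarrow> sectional_curvature g x0 u v = 0"
  shows "K a b b \<bullet> a = 0"
proof (cases "(a \<bullet> a) * (b \<bullet> b) - (a \<bullet> b)\<^sup>2 = 0")
  case False
  let ?u = "E x0 a" and ?v = "E x0 b"
  have lin: "g x0 (r *\<^sub>R v) w = r * g x0 v w" "g x0 v (r *\<^sub>R w) = r * g x0 v w" for r v w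
    using bilinear_lmul[OF g_bilinear[OF x0]] bilinear_rmul[OF g_bilinear[OF x0]] by auto
  have area: "g x0 ?u ?u * g x0 ?v ?v - (g x0 ?u ?v)\<^sup>2 \<noteq> 0"
    using False by (simp add: E_orthonormal x0)
  have nu: "?u \<notin> span {?v}"
    using area by (auto simp: span_singleton lin power2_eq_square)
  then have "?u \<noteq> ?v" by (auto intro: span_base)
  moreover have "?v \<noteq> 0"
    using area linear_0[OF g_linear(1)[OF x0]] by (auto simp: power2_eq_square)
  then have "independent {?u, ?v}"
    using nu by (simp add: independent_insert)
  ultimately have "g x0 (E x0 (K a b b)) ?u = 0"
    using flat[of ?u ?v] area by (simp add: sectional_curvature_def riemann_curvature_frame[OF x0])
  then show ?thesis by (simp add: E_orthonormal x0)
next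
  case True
  \<comment> \<open>The equality case of the Cauchy-Schwarz inequality.\<close>
  have "((a \<bullet> a) *\<^sub>R b - (a \<bullet> b) *\<^sub>R a) \<bullet> ((a \<bullet> a) *\<^sub>R b - (a \<bullet> b) *\<^sub>R a)
      = (a \<bullet> a) * ((a \<bullet> a) * (b \<bullet> b) - (a \<bullet> b)\<^sup>2)"
    by (simp add: inner_diff_left inner_diff_right inner_commute power2_eq_square algebra_simps)
  then have "(a \<bullet> a) *\<^sub>R b = (a \<bullet> b) *\<^sub>R a"
    using True by simp
  moreover have "K a a c = 0" for c
    using K_skew12[of a a c] by (metis eq_neg_iff_add_eq_0 scaleR_2 scale_eq_0_iff zero_neq_numeral)
  ultimately have "(a \<bullet> a) *\<^sub>R K a b b = 0"
    using K_linear(3)[of a "a \<bullet> a" b b] K_linear(3)[of a "a \<bullet> b" a b] by simp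
  then show ?thesis by (cases "a = 0") auto
qed

text \<open>Since \<open>\<eta>\<close> is constant on frame fields, differentiating \<open>\<eta>\<close> at a constant vector amounts to
differentiating the frame, and the two derivatives form a bracket.\<close>

lemma ext_deriv_frame:
  assumes lin: "\<And>x. x \<in> S \<Longrightarrow> linear (\<eta> x)"
    and diff: "\<And>v. (\<lambda>y. \<eta> y v) differentiable (at x0)"
    and inv: "\<And>x a. x \<in> S \<Longrightarrow> \<eta> x (E x a) = \<xi> \<bullet> a"
  shows "ext_deriv \<eta> x0 v = - (\<xi> \<bullet> br (coframe x0 (v 0)) (coframe x0 (v 1)))"
proof -
  have deriv: "frechet_derivative (\<lambda>y. \<eta> y (E x0 a)) (at x0) u = - \<eta> x0 (DE x0 u a)" for u a
  proof -
    have "((\<lambda>y. \<eta> y (E y a)) has_derivative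
        (\<lambda>u. frechet_derivative (\<lambda>y. \<eta> y (E x0 a)) (at x0) u + \<eta> x0 (DE x0 u a))) (at x0)"
      by (rule has_derivative_linear_family[OF open_S x0 lin _ E_deriv[OF x0]])
        (use diff frechet_derivative_works in auto)
    then have "((\<lambda>y. \<xi> \<bullet> a) has_derivative
        (\<lambda>u. frechet_derivative (\<lambda>y. \<eta> y (E x0 a)) (at x0) u + \<eta> x0 (DE x0 u a))) (at x0)"
      by (rule has_derivative_transform_within_open[OF _ open_S x0]) (rule inv)
    from fun_cong[OF has_derivative_unique[OF this has_derivative_const], of u]
    show ?thesis by simp
  qed
  define a b where "a = coframe x0 (v 0)" and "b = coframe x0 (v 1)"
  have v: "v 0 = E x0 a" "v 1 = E x0 b"
    by (simp_all add: a_def b_def E_coframe x0)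
  have "ext_deriv \<eta> x0 v = - \<eta> x0 (DE x0 (E x0 a) b - DE x0 (E x0 b) a)"
    unfolding ext_deriv_def v deriv by (simp add: linear_diff[OF lin[OF x0]])
  also have "\<dots> = - (\<xi> \<bullet> br a b)"
    by (simp add: E_bracket x0 inv)
  finally show ?thesis unfolding a_def b_def .
qed

text \<open>Evaluating at \<open>x0\<close> suffices: the sectional curvatures at one point make \<open>K\<close> zero, which turns \<open>N\<close>
into a flat product, and nondegeneracy at one point is the condition in \<open>contact_dim_bound\<close>.\<close>

theorem flat_contact_dim_le_3:
  assumes flat: "\<And>u v. u \<noteq> v \<Longrightarrow> independent {u, v} \<Longrightarrow> sectional_curvature g x0 u v = 0"
    and lin: "\<And>x. x \<in> S \<Longrightarrow> linear (\<eta> x)"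
    and diff: "\<And>v. (\<lambda>y. \<eta> y v) differentiable (at x0)"
    and inv: "\<And>x a. x \<in> S \<Longrightarrow> \<eta> x (E x a) = \<xi> \<bullet> a"
    and dim: "DIM('e) = 2 * n + 1"
    and contact: "wedge (2 * n) 1 (wedge_power2 n (ext_deriv \<eta> x0)) (\<lambda>u. \<eta> x0 (u 0)) v \<noteq> 0"
  shows "DIM('e) \<le> 3"
proof -
  have "K a b c \<bullet> d = 0" for a b c d
  proof (rule curvature_tensor_vanishes[where R = "\<lambda>a b c d. K a b c \<bullet> d"])
    show "K a b c \<bullet> d + K b c a \<bullet> d + K c a b \<bullet> d = 0" for a b c d
      by (simp add: K_bianchi flip: inner_add_left)
    show "K a b c \<bullet> d = - (K b a c \<bullet> d)" for a b c d
      by (subst K_skew12) simp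
    show "K a b b \<bullet> a = 0" for a b
      using flat by (rule K_sectional)
    show "K a b c \<bullet> d = - (K a b d \<bullet> c)" for a b c d
      by (rule K_skew34)
  qed (simp_all add: K_linear inner_add_left)
  then have K0: "K a b c = 0" for a b c
    by (metis inner_eq_zero_iff)
  interpret flat_lie_product N
  proof
    show "N (N a b - N b a) c = N a (N b c) - N b (N a c)" for a b c
      using K0[of a b c] by (simp add: K_def N_torsion)
  qed (rule bilinear_N N_skew)+
  define \<omega> where "\<omega> = ext_deriv \<eta> x0"
  have \<omega>: "\<omega> v = - (\<xi> \<bullet> br (coframe x0 (v 0)) (coframe x0 (v 1)))" for v
    unfolding \<omega>_def by (rule ext_deriv_frame[OF lin diff inv])
  have "multilinear_form 2 \<omega>"
    unfolding multilinear_form_def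
  proof (intro conjI allI impI)
    fix v w :: "nat \<Rightarrow> 'e" assume "\<forall>i<2. v i = w i"
    then show "\<omega> v = \<omega> w" by (simp add: \<omega>)
  next
    fix j :: nat and v :: "nat \<Rightarrow> 'e" assume "j < 2"
    then have "j = 0 \<or> j = 1" by auto
    then show "linear (\<lambda>x. \<omega> (v(j := x)))"
      by (auto intro!: linearI simp: \<omega> br_simps linear_add[OF coframe_linear[OF x0]]
          linear_scale[OF coframe_linear[OF x0]] inner_add_right)
  qed
  moreover have "multilinear_form 1 (\<lambda>u. \<eta> x0 (u 0))"
    using lin[OF x0] by (auto simp: multilinear_form_def)
  ultimately have forms: "multilinear_form (2 * n) (wedge_power2 n \<omega>)" "multilinear_form 1 (\<lambda>u. \<eta> x0 (u 0))"
    by (auto intro: multilinear_wedge_power2)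
  have "z = 0" if z: "\<xi> \<bullet> z = 0" "\<And>w. \<xi> \<bullet> (N z w - N w z) = 0" for z
  proof (rule ccontr)
    assume "z \<noteq> 0"
    define Z where "Z = E x0 z"
    have cZ: "coframe x0 Z = z" by (simp add: Z_def coframe_E x0)
    have "Z \<noteq> 0"
      using cZ \<open>z \<noteq> 0\<close> linear_0[OF coframe_linear[OF x0]] by metis
    have br0: "\<xi> \<bullet> br z w = 0" "\<xi> \<bullet> br w z = 0" for w
      using z(2)[of w] br_skew[of w z] by (simp_all add: N_torsion)
    have "annihilates 2 Z \<omega>"
      unfolding annihilates_def
    proof (intro allI impI)
      fix v :: "nat \<Rightarrow> 'e" assume "\<exists>i<2. v i = Z"
      then have "v 0 = Z \<or> v 1 = Z" by (auto simp: less_2_cases_iff)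
      then show "\<omega> v = 0" by (elim disjE) (simp_all only: \<omega> cZ br0 minus_zero)
    qed
    then have "annihilates (2 * n) Z (wedge_power2 n \<omega>)"
      by (rule annihilates_wedge_power2)
    moreover have "annihilates 1 Z (\<lambda>u. \<eta> x0 (u 0))"
      using z(1) by (auto simp: annihilates_def Z_def inv x0)
    ultimately show False
      using wedge_top_degree_annihilated[OF forms(1) _ forms(2) _ dim \<open>Z \<noteq> 0\<close>] contact
      unfolding \<omega>_def by blast
  qed
  then show ?thesis by (rule contact_dim_bound)
qed

end

section \<open>Left invariant vector fields in a chart\<close>

text \<open>The multiplication of a Lie group in a chart around the identity, which has coordinates \<open>x0\<close>; \<open>W\<close>
consists of the pairs whose product stays in the chart.\<close>

locale local_lie_group =
  fixes S :: "'e::euclidean_space set" and W :: "('e \<times> 'e) set" and m :: "'e \<times> 'e \<Rightarrow> 'e" and x0 :: 'e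
  assumes open_S: "open S" and x0: "x0 \<in> S"
    and W_subset: "W \<subseteq> S \<times> S" and m_in: "p \<in> W \<Longrightarrow> m p \<in> S"
    and unit: "x \<in> S \<Longrightarrow> (x, x0) \<in> W" "x \<in> S \<Longrightarrow> m (x, x0) = x"
    and smooth: "smooth_on W m"
    and assoc: "(x, y) \<in> W \<Longrightarrow> (y, z) \<in> W \<Longrightarrow> (m (x, y), z) \<in> W \<Longrightarrow> (x, m (y, z)) \<in> W \<Longrightarrow>
      m (m (x, y), z) = m (x, m (y, z))"
begin

definition dm :: "'e \<times> 'e \<Rightarrow> 'e \<times> 'e \<Rightarrow> 'e" where
  "dm p v = frechet_derivative m (at p) v"

definition d2m :: "'e \<times> 'e \<Rightarrow> 'e \<times> 'e \<Rightarrow> 'e \<times> 'e \<Rightarrow> 'e" where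
  "d2m p v u = frechet_derivative (\<lambda>q. dm q v) (at p) u"

definition d3m :: "'e \<times> 'e \<Rightarrow> 'e \<times> 'e \<Rightarrow> 'e \<times> 'e \<Rightarrow> 'e \<times> 'e \<Rightarrow> 'e" where
  "d3m p v u t = frechet_derivative (\<lambda>q. d2m q v u) (at p) t"

lemma open_W: "open W"
  using smooth by (simp add: smooth_on_def)

lemma smooth_dm: "smooth_on W (\<lambda>p. dm p v)"
  unfolding dm_def by (rule smooth_on_derivative[OF smooth])

lemma smooth_d2m: "smooth_on W (\<lambda>p. d2m p v u)"
  unfolding d2m_def by (rule smooth_on_derivative[OF smooth_dm])

lemma m_deriv: "p \<in> W \<Longrightarrow> (m has_derivative dm p) (at p)"
  unfolding dm_def by (rule smooth_on_has_derivative[OF smooth])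

lemma dm_deriv: "p \<in> W \<Longrightarrow> ((\<lambda>q. dm q v) has_derivative d2m p v) (at p)"
  unfolding d2m_def by (rule smooth_on_has_derivative[OF smooth_dm])

lemma d2m_deriv: "p \<in> W \<Longrightarrow> ((\<lambda>q. d2m q v u) has_derivative d3m p v u) (at p)"
  unfolding d3m_def by (rule smooth_on_has_derivative[OF smooth_d2m])

lemma d2m_commute: "p \<in> W \<Longrightarrow> d2m p v u = d2m p u v"
  unfolding d2m_def dm_def by (rule smooth_on_second_derivative_commute[OF smooth])

lemma d3m_commute: "p \<in> W \<Longrightarrow> d3m p v u t = d3m p v t u"
  unfolding d3m_def d2m_def by (rule smooth_on_second_derivative_commute[OF smooth_dm])

lemma dm_linear: "p \<in> W \<Longrightarrow> linear (dm p)"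
  by (rule has_derivative_linear[OF m_deriv])

lemma derivative_first_slot:
  "(F has_derivative F') (at (x, y)) \<Longrightarrow> ((\<lambda>s. F (s, y)) has_derivative (\<lambda>u. F' (u, 0))) (at x)"
  by (rule has_derivative_compose[of "\<lambda>s. (s, y)" "\<lambda>u. (u, 0)" _ _ F F'])
    (auto intro!: derivative_eq_intros)

lemma derivative_second_slot:
  "(F has_derivative F') (at (x, y)) \<Longrightarrow> ((\<lambda>s. F (x, s)) has_derivative (\<lambda>u. F' (0, u))) (at y)"
  by (rule has_derivative_compose[of "\<lambda>s. (x, s)" "\<lambda>u. (0, u)" _ _ F F'])
    (auto intro!: derivative_eq_intros)

text \<open>The left invariant field with value \<open>w\<close> at the identity: the image of \<open>w\<close> under the derivative of the
left translation by \<open>x\<close>.\<close>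

definition left_field :: "'e \<Rightarrow> 'e \<Rightarrow> 'e" where
  "left_field x w = dm (x, x0) (0, w)"

definition left_field_deriv :: "'e \<Rightarrow> 'e \<Rightarrow> 'e \<Rightarrow> 'e" where
  "left_field_deriv x u w = d2m (x, x0) (0, w) (u, 0)"

lemma left_field_deriv:
  "x \<in> S \<Longrightarrow> ((\<lambda>y. left_field y w) has_derivative (\<lambda>u. left_field_deriv x u w)) (at x)"
  unfolding left_field_def left_field_deriv_def
  by (rule derivative_first_slot[OF dm_deriv[OF unit(1)]])

lemma left_field_linear: "x \<in> S \<Longrightarrow> linear (left_field x)"
  unfolding left_field_def
  using dm_linear[OF unit(1), of x]
  by (auto intro!: linearI simp: linear_add[symmetric] linear_scale[symmetric])

text \<open>Differentiate the associative law in its third argument at the identity.\<close>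

lemma left_field_invariant:
  assumes xy: "(x, y) \<in> W"
  shows "left_field (m (x, y)) w = dm (x, y) (0, left_field y w)"
proof -
  have x: "x \<in> S" and y: "y \<in> S" using xy W_subset by auto
  have mxy: "m (x, y) \<in> S" using xy by (rule m_in)
  have d1: "((\<lambda>z. m (m (x, y), z)) has_derivative (\<lambda>w. left_field (m (x, y)) w)) (at x0)"
    unfolding left_field_def by (rule derivative_second_slot[OF m_deriv[OF unit(1)[OF mxy]]])
  have d2: "((\<lambda>z. m (y, z)) has_derivative (\<lambda>w. left_field y w)) (at x0)"
    unfolding left_field_def by (rule derivative_second_slot[OF m_deriv[OF unit(1)[OF y]]])
  have d3: "((\<lambda>z. m (x, z)) has_derivative (\<lambda>w. dm (x, y) (0, w))) (at (m (y, x0)))"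
    unfolding unit(2)[OF y] by (rule derivative_second_slot[OF m_deriv[OF xy]])
  have d4: "((\<lambda>z. m (x, m (y, z))) has_derivative (\<lambda>w. dm (x, y) (0, left_field y w))) (at x0)"
    by (rule has_derivative_compose[OF d2 d3])
  \<comment> \<open>All products in the associative law are defined for \<open>z\<close> near the identity.\<close>
  have near: "\<forall>\<^sub>F z in nhds x0. F z \<in> W" if "isCont F x0" "F x0 \<in> W" for F
    using that open_W unfolding continuous_at tendsto_at_iff_tendsto_nhds
    by (metis topological_tendstoD)
  have c: "isCont (\<lambda>z. (a, z)) x0" for a :: 'e
    by (intro continuous_intros)
  have "isCont (\<lambda>z. m (y, z)) x0"
    using has_derivative_continuous[OF d2] .
  then have c3: "isCont (\<lambda>z. (x, m (y, z))) x0"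
    by (intro continuous_intros)
  have "\<forall>\<^sub>F z in nhds x0. m (m (x, y), z) = m (x, m (y, z))"
    using near[OF c unit(1)[OF y]] near[OF c unit(1)[OF mxy]]
      near[OF c3, unfolded unit(2)[OF y], OF xy]
    by eventually_elim (rule assoc[OF xy])
  then have ev: "\<forall>\<^sub>F z in at x0. m (m (x, y), z) = m (x, m (y, z))"
    and eq: "m (m (x, y), x0) = m (x, m (y, x0))"
    by (simp_all add: eventually_nhds_conv_at)
  have "((\<lambda>z. m (x, m (y, z))) has_derivative (\<lambda>w. left_field (m (x, y)) w)) (at x0)"
    by (rule has_derivative_transform_eventually[OF d1 ev eq]) simp
  from fun_cong[OF has_derivative_unique[OF this d4], of w] show ?thesis by simp
qed

lemma left_field_at_unit: "x \<in> S \<Longrightarrow> left_field x (left_field x0 w) = left_field x w"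
  using left_field_invariant[OF unit(1), of x w] by (simp add: unit(2) left_field_def)

definition lie_bracket :: "'e \<Rightarrow> 'e \<Rightarrow> 'e" where
  "lie_bracket v w = left_field_deriv x0 (left_field x0 v) w - left_field_deriv x0 (left_field x0 w) v"

text \<open>Differentiate the invariance of the field \<open>w\<close> under left translation by \<open>x\<close>, at the identity along
the field \<open>v\<close>. The second derivative of the translation appears symmetrically in \<open>v\<close> and \<open>w\<close> and
drops out of the bracket, so that the bracket at \<open>x\<close> is the translate of the bracket at the identity.\<close>

lemma left_field_bracket:
  assumes x: "x \<in> S"
  shows "left_field_deriv x (left_field x v) w - left_field_deriv x (left_field x w) v
    = left_field x (lie_bracket v w)"
proof -
  have expand: "left_field_deriv x (left_field x v) w
    = d2m (x, x0) (0, left_field x0 w) (0, left_field x0 v) + left_field x (left_field_deriv x0 (left_field x0 v) w)"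
    for v w
  proof -
    define Y where "Y = {y. (x, y) \<in> W}"
    have "continuous_on UNIV (\<lambda>y. (x, y))"
      by (intro continuous_intros)
    from open_vimage[OF open_W this] have Y: "open Y" "x0 \<in> Y"
      using unit(1)[OF x] by (simp_all add: Y_def vimage_def)
    have d1: "((\<lambda>y. m (x, y)) has_derivative (\<lambda>h. left_field x h)) (at x0)"
      unfolding left_field_def by (rule derivative_second_slot[OF m_deriv[OF unit(1)[OF x]]])
    have d2: "((\<lambda>y. left_field y w) has_derivative (\<lambda>u. left_field_deriv x u w)) (at (m (x, x0)))"
      unfolding unit(2)[OF x] by (rule left_field_deriv[OF x])
    have lhs: "((\<lambda>y. left_field (m (x, y)) w) has_derivative
        (\<lambda>h. left_field_deriv x (left_field x h) w)) (at x0)"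
      by (rule has_derivative_compose[OF d1 d2])
    have lin: "linear (\<lambda>u. dm (x, y) (0, u))" if "y \<in> Y" for y
      using dm_linear[of "(x, y)"] that
      by (auto intro!: linearI simp: Y_def linear_add[symmetric] linear_scale[symmetric])
    have rhs: "((\<lambda>y. dm (x, y) (0, left_field y w)) has_derivative
        (\<lambda>h. d2m (x, x0) (0, left_field x0 w) (0, h) + dm (x, x0) (0, left_field_deriv x0 h w))) (at x0)"
      by (rule has_derivative_linear_family[OF Y, of "\<lambda>y u. dm (x, y) (0, u)"
            "\<lambda>h u. d2m (x, x0) (0, u) (0, h)", OF lin
            derivative_second_slot[OF dm_deriv[OF unit(1)[OF x]]] left_field_deriv[OF x0]])
    have "((\<lambda>y. left_field (m (x, y)) w) has_derivative
        (\<lambda>h. d2m (x, x0) (0, left_field x0 w) (0, h) + dm (x, x0) (0, left_field_deriv x0 h w))) (at x0)"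
      by (rule has_derivative_transform_within_open[OF rhs Y])
        (simp add: Y_def left_field_invariant)
    from fun_cong[OF has_derivative_unique[OF lhs this], of "left_field x0 v"]
    show ?thesis by (simp add: left_field_at_unit[OF x]) (simp add: left_field_def)
  qed
  show ?thesis
    unfolding expand lie_bracket_def
    by (simp add: d2m_commute[OF unit(1)[OF x], of "(0, left_field x0 v)"]
        linear_diff[OF left_field_linear[OF x]])
qed

text \<open>The left invariant fields become an orthonormal frame after a linear change \<open>P\<close> of the vectors at the
identity.\<close>

theorem flat_contact_dim_le_3:
  fixes g :: "'e \<Rightarrow> 'e \<Rightarrow> 'e \<Rightarrow> real" and \<eta> :: "'e \<Rightarrow> 'e \<Rightarrow> real"
  assumes g: "\<And>x. x \<in> S \<Longrightarrow> bilinear (g x)" "\<And>x v w. x \<in> S \<Longrightarrow> g x v w = g x w v"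
      "\<And>x v. x \<in> S \<Longrightarrow> v \<noteq> 0 \<Longrightarrow> g x v v > 0"
      "\<And>x v w. x \<in> S \<Longrightarrow> (\<lambda>y. g y v w) differentiable (at x)"
    and g_inv: "\<And>x v w. x \<in> S \<Longrightarrow> g x (left_field x v) (left_field x w) = g x0 v w"
    and flat: "\<And>u v. u \<noteq> v \<Longrightarrow> independent {u, v} \<Longrightarrow> sectional_curvature g x0 u v = 0"
    and \<eta>: "\<And>x. x \<in> S \<Longrightarrow> linear (\<eta> x)" "\<And>v. (\<lambda>y. \<eta> y v) differentiable (at x0)"
    and \<eta>_inv: "\<And>x v. x \<in> S \<Longrightarrow> \<eta> x (left_field x v) = \<eta> x0 v"
    and dim: "DIM('e) = 2 * n + 1"
    and contact: "wedge (2 * n) 1 (wedge_power2 n (ext_deriv \<eta> x0)) (\<lambda>u. \<eta> x0 (u 0)) v \<noteq> 0"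
  shows "DIM('e) \<le> 3"
proof -
  obtain P :: "'e \<Rightarrow> 'e" where P: "linear P" "bij P" "\<And>a b. g x0 (P a) (P b) = a \<bullet> b"
    by (rule orthonormal_frame_of_form[OF g(1)[OF x0] g(2)[OF x0] g(3)[OF x0]]) (assumption | rule that)+
  define E where "E x a = left_field x (P a)" for x a
  define DE where "DE x u a = left_field_deriv x u (P a)" for x u a
  define D2E where "D2E x v u a = d3m (x, x0) (0, P a) (u, 0) (v, 0)" for x v u a
  define br where "br a b = inv_into UNIV P (lie_bracket (P a) (P b))" for a b
  interpret left_invariant_frame S g E DE D2E br x0
  proof
    fix x assume x: "x \<in> S"
    show "E x (a + b) = E x a + E x b" "E x (r *\<^sub>R a) = r *\<^sub>R E x a" for a b r
      using P(1) left_field_linear[OF x] by (simp_all add: E_def linear_add linear_scale)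
    show "((\<lambda>y. E y a) has_derivative (\<lambda>u. DE x u a)) (at x)" for a
      unfolding E_def DE_def by (rule left_field_deriv[OF x])
    show "((\<lambda>y. DE y u a) has_derivative (\<lambda>v. D2E x v u a)) (at x)" for u a
      unfolding DE_def D2E_def left_field_deriv_def
      by (rule derivative_first_slot[OF d2m_deriv[OF unit(1)[OF x]]])
    show "D2E x v u a = D2E x u v a" for u v a
      unfolding D2E_def by (rule d3m_commute[OF unit(1)[OF x]])
    show "g x (E x a) (E x b) = a \<bullet> b" for a b
      by (simp add: E_def g_inv[OF x] P(3))
    show "DE x (E x a) b - DE x (E x b) a = E x (br a b)" for a b
      using left_field_bracket[OF x, of "P a" "P b"] P(2)
      by (simp add: E_def DE_def br_def bij_is_surj surj_f_inv_f)
  qed (use open_S x0 g in auto)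
  define \<xi> where "\<xi> = (\<Sum>b\<in>Basis. \<eta> x0 (P b) *\<^sub>R b)"
  have \<eta>P: "linear (\<lambda>a. \<eta> x0 (P a))"
    using linear_compose[OF P(1) \<eta>(1)[OF x0]] by (simp add: comp_def)
  have \<xi>: "\<eta> x (E x a) = \<xi> \<bullet> a" if "x \<in> S" for x a
  proof -
    have "\<eta> x (E x a) = \<eta> x0 (P (\<Sum>b\<in>Basis. (a \<bullet> b) *\<^sub>R b))"
      by (simp add: E_def \<eta>_inv[OF that] euclidean_representation)
    also have "\<dots> = (\<Sum>b\<in>Basis. (a \<bullet> b) * \<eta> x0 (P b))"
      by (simp only: linear_sum[OF \<eta>P] linear_scale[OF \<eta>P] real_scaleR_def)
    also have "\<dots> = \<xi> \<bullet> a"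
      by (simp add: \<xi>_def inner_sum_left inner_commute[of a] mult.commute)
    finally show ?thesis .
  qed
  show ?thesis
    by (rule flat_contact_dim_le_3[OF flat \<eta> \<xi> dim contact])
qed

end

section \<open>Flat left invariant metrics and contact structures on Lie groups\<close>

theorem theorem5:
  fixes G :: "('a, 'b) monoid_scheme"
    and T :: "'a topology"
    and A :: "('a, 'e::euclidean_space) chart set"
  assumes "lie_group G T A"
    and "DIM('e) \<ge> 5"
    and "\<exists>\<eta>. contact_form A \<eta> \<and> left_invariant1 G A \<eta>"
  shows "\<not> (\<exists>g. riemannian_metric A g \<and> left_invariant2 G A g \<and> flat_metric A g)"
proof
  assume "\<exists>g. riemannian_metric A g \<and> left_invariant2 G A g \<and> flat_metric A g"
  then obtain g where g: "riemannian_metric A g" "left_invariant2 G A g" "flat_metric A g"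
    by blast
  obtain \<eta> where \<eta>: "contact_form A \<eta>" "left_invariant1 G A \<eta>"
    using assms(3) by blast
  interpret lie_group G T A by fact
  obtain c where c: "c \<in> A" "\<one>\<^bsub>G\<^esub> \<in> fst c"
    using charts_cover topspace_carrier one_closed by blast
  define U \<phi> S where "U = fst c" and "\<phi> = snd c" and "S = chart_image c"
  have S: "S = \<phi> ` U" by (simp add: S_def chart_image_def U_def \<phi>_def)
  have "is_chart T c" using charts c by blast
  then have "U \<subseteq> topspace T" and open_S: "open S"
    and "homeomorphic_map (subtopology T U) (top_of_set S) \<phi>"
    by (auto simp: is_chart_def U_def \<phi>_def S_def openin_subset)
  then have U: "U \<subseteq> carrier G" and inj: "inj_on \<phi> U"
    using homeomorphic_imp_injective_map[of "subtopology T U" "top_of_set S" \<phi>]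
    by (simp_all add: topspace_carrier Int_absorb1)
  have one: "\<one>\<^bsub>G\<^esub> \<in> U" using c by (simp add: U_def)
  define \<mu> where "\<mu> = (\<lambda>(x, y). x \<otimes>\<^bsub>G\<^esub> y)"
  define cc where "cc = (U \<times> U, map_prod \<phi> \<phi>)"
  define m where "m = coord_rep cc c \<mu>"
  define W where "W = coord_dom cc c \<mu>"
  have "cc \<in> prod_atlas A A"
    unfolding prod_atlas_def
    by (intro CollectI exI[of _ c]) (use c(1) in \<open>simp add: cc_def U_def \<phi>_def\<close>)
  then have smooth: "smooth_on W m"
    using smooth_mult c(1) by (simp add: smooth_map_def W_def m_def \<mu>_def)
  have W: "(x, y) \<in> W \<longleftrightarrow> (\<exists>a\<in>U. \<exists>b\<in>U. x = \<phi> a \<and> y = \<phi> b \<and> a \<otimes>\<^bsub>G\<^esub> b \<in> U)" for x y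
    by (auto simp: W_def coord_dom_def cc_def \<mu>_def U_def[symmetric])
  have m: "m (\<phi> a, \<phi> b) = \<phi> (a \<otimes>\<^bsub>G\<^esub> b)" if "a \<in> U" "b \<in> U" for a b
  proof -
    have "inv_into (U \<times> U) (map_prod \<phi> \<phi>) (map_prod \<phi> \<phi> (a, b)) = (a, b)"
      using inj that by (intro inv_into_f_f map_prod_inj_on) auto
    then show ?thesis
      by (simp add: m_def coord_rep_def cc_def \<mu>_def \<phi>_def)
  qed
  have W_\<phi>: "(\<phi> a, \<phi> b) \<in> W \<longleftrightarrow> a \<otimes>\<^bsub>G\<^esub> b \<in> U" if "a \<in> U" "b \<in> U" for a b
    using that inj by (auto simp: W inj_on_eq_iff)
  interpret L: local_lie_group S W m "\<phi> \<one>\<^bsub>G\<^esub>"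
  proof
    show "open S" by (rule open_S)
    show "\<phi> \<one>\<^bsub>G\<^esub> \<in> S" using one by (simp add: S)
    show "W \<subseteq> S \<times> S" by (auto simp: W S)
    show "m p \<in> S" if "p \<in> W" for p
      using that by (cases p) (auto simp: W m S)
    show "(x, \<phi> \<one>\<^bsub>G\<^esub>) \<in> W" "m (x, \<phi> \<one>\<^bsub>G\<^esub>) = x" if "x \<in> S" for x
      using that one U by (auto simp: S W_\<phi> m subset_iff)
    show "smooth_on W m" by (rule smooth)
    fix x y z assume xy: "(x, y) \<in> W" and yz: "(y, z) \<in> W"
      and l: "(m (x, y), z) \<in> W" and r: "(x, m (y, z)) \<in> W"
    obtain a b where a: "a \<in> U" "b \<in> U" "x = \<phi> a" "y = \<phi> b" "a \<otimes>\<^bsub>G\<^esub> b \<in> U"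
      using xy by (auto simp: W)
    obtain d where d: "d \<in> U" "z = \<phi> d"
      using yz by (auto simp: W)
    have "b \<otimes>\<^bsub>G\<^esub> d \<in> U"
      using yz a d by (simp add: W_\<phi>)
    then show "m (m (x, y), z) = m (x, m (y, z))"
      using a d U by (simp add: m m_assoc subset_iff)
  qed
  \<comment> \<open>The chart expression of the left translation by \<open>a\<close> agrees with \<open>m (\<phi> a, _)\<close> on all of \<open>S\<close>.\<close>
  have translate: "\<phi> \<one>\<^bsub>G\<^esub> \<in> coord_dom c c (\<lambda>x. a \<otimes>\<^bsub>G\<^esub> x)"
    "coord_rep c c (\<lambda>x. a \<otimes>\<^bsub>G\<^esub> x) (\<phi> \<one>\<^bsub>G\<^esub>) = \<phi> a"
    "frechet_derivative (coord_rep c c (\<lambda>x. a \<otimes>\<^bsub>G\<^esub> x)) (at (\<phi> \<one>\<^bsub>G\<^esub>)) v = L.left_field (\<phi> a) v"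
    if a: "a \<in> U" for a v
  proof -
    have rep: "coord_rep c c (\<lambda>x. a \<otimes>\<^bsub>G\<^esub> x) (\<phi> b) = \<phi> (a \<otimes>\<^bsub>G\<^esub> b)" if "b \<in> U" for b
      using inj that by (simp add: coord_rep_def U_def[symmetric] \<phi>_def[symmetric])
    show "\<phi> \<one>\<^bsub>G\<^esub> \<in> coord_dom c c (\<lambda>x. a \<otimes>\<^bsub>G\<^esub> x)"
      using one a U by (auto simp: coord_dom_def U_def[symmetric] \<phi>_def[symmetric] subset_iff
          intro!: imageI)
    show "coord_rep c c (\<lambda>x. a \<otimes>\<^bsub>G\<^esub> x) (\<phi> \<one>\<^bsub>G\<^esub>) = \<phi> a"
      using rep[OF one] a U by (simp add: subset_iff)
    have "\<phi> a \<in> S" using a by (simp add: S)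
    have "((\<lambda>y. m (\<phi> a, y)) has_derivative L.left_field (\<phi> a)) (at (\<phi> \<one>\<^bsub>G\<^esub>))"
      unfolding L.left_field_def
      by (rule L.derivative_second_slot[OF L.m_deriv[OF L.unit(1)[OF \<open>\<phi> a \<in> S\<close>]]])
    then have "(coord_rep c c (\<lambda>x. a \<otimes>\<^bsub>G\<^esub> x) has_derivative L.left_field (\<phi> a)) (at (\<phi> \<one>\<^bsub>G\<^esub>))"
      by (rule has_derivative_transform_within_open[OF _ open_S L.x0])
        (auto simp: S rep m a)
    from fun_cong[OF frechet_derivative_at[OF this], of v]
    show "frechet_derivative (coord_rep c c (\<lambda>x. a \<otimes>\<^bsub>G\<^esub> x)) (at (\<phi> \<one>\<^bsub>G\<^esub>)) v = L.left_field (\<phi> a) v"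
      by simp
  qed
  have g_inv: "g c x (L.left_field x v) (L.left_field x w) = g c (\<phi> \<one>\<^bsub>G\<^esub>) v w" if x: "x \<in> S" for x v w
  proof -
    obtain a where a: "a \<in> U" "x = \<phi> a" using x by (auto simp: S)
    have "pullback_invariant2 A (\<lambda>x. a \<otimes>\<^bsub>G\<^esub> x) (g)"
      using g(2) a U by (auto simp: left_invariant2_def)
    from this[unfolded pullback_invariant2_def, rule_format, OF c(1) c(1) translate(1)[OF a(1)], of v w]
    show ?thesis by (simp add: translate[OF a(1)] a(2))
  qed
  have \<eta>_inv: "\<eta> c x (L.left_field x v) = \<eta> c (\<phi> \<one>\<^bsub>G\<^esub>) v" if x: "x \<in> S" for x v
  proof -
    obtain a where a: "a \<in> U" "x = \<phi> a" using x by (auto simp: S)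
    have "pullback_invariant1 A (\<lambda>x. a \<otimes>\<^bsub>G\<^esub> x) \<eta>"
      using \<eta>(2) a U by (auto simp: left_invariant1_def)
    from this[unfolded pullback_invariant1_def, rule_format, OF c(1) c(1) translate(1)[OF a(1)], of v]
    show ?thesis by (simp add: translate[OF a(1)] a(2))
  qed
  obtain n where n: "DIM('e) = 2 * n + 1"
    "\<forall>c\<in>A. \<forall>x\<in>chart_image c. \<exists>v.
      wedge (2 * n) 1 (wedge_power2 n (ext_deriv (\<eta> c) x)) (\<lambda>u. \<eta> c x (u 0)) v \<noteq> 0"
    using \<eta>(1) by (auto simp: contact_form_def)
  then obtain v where v:
    "wedge (2 * n) 1 (wedge_power2 n (ext_deriv (\<eta> c) (\<phi> \<one>\<^bsub>G\<^esub>))) (\<lambda>u. \<eta> c (\<phi> \<one>\<^bsub>G\<^esub>) (u 0)) v \<noteq> 0"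
    using c(1) L.x0 unfolding S_def by blast
  have "DIM('e) \<le> 3"
  proof (rule L.flat_contact_dim_le_3[where g = "g c" and \<eta> = "\<eta> c", OF _ _ _ _ g_inv _ _ _ \<eta>_inv n(1) v])
    fix x v w assume x: "x \<in> S"
    show "bilinear (g c x)" "g c x v w = g c x w v"
      using g(1) c(1) x by (auto simp: riemannian_metric_def S_def)
    show "v \<noteq> 0 \<Longrightarrow> g c x v v > 0"
      using g(1) c(1) x by (auto simp: riemannian_metric_def S_def)
    have "smooth_on S (\<lambda>y. g c y v w)"
      using g(1) c(1) by (auto simp: riemannian_metric_def S_def)
    from smooth_on_has_derivative[OF this x] show "(\<lambda>y. g c y v w) differentiable (at x)"
      by (rule differentiableI)
    show "linear (\<eta> c x)"
      using \<eta>(1) c(1) x by (auto simp: contact_form_def smooth_one_form_def S_def)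
  next
    fix u v :: 'e assume "u \<noteq> v" "independent {u, v}"
    then show "sectional_curvature (g c) (\<phi> \<one>\<^bsub>G\<^esub>) u v = 0"
      using g(3) c(1) L.x0 by (auto simp: flat_metric_def S_def)
  next
    fix v
    have "smooth_on S (\<lambda>y. \<eta> c y v)"
      using \<eta>(1) c(1) by (auto simp: contact_form_def smooth_one_form_def S_def)
    from smooth_on_has_derivative[OF this L.x0] show "(\<lambda>y. \<eta> c y v) differentiable (at (\<phi> \<one>\<^bsub>G\<^esub>))"
      by (rule differentiableI)
  qed
  with assms(2) show False by simp
qed

end
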